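(* Let $D$ be an oriented link diagram on an oriented compact surface $F$ with $n_-(D)$ negative crossings, and let $(A,\tau)$ be the unoriented HQFT over $\mathbf F_2$ with target $K(H_1(F;\mathbf F_2),1)$ corresponding to the extended crossed $H_1(F;\mathbf F_2)$-algebra $L$ described in the context. Then $H^{-n_-(D)}_{(A,\tau)}(F,D)\neq 0$ if and only if $(F,D)$ is weak plus-adequate.
   Context: **The algebra.** Put $\pi=H_1(F;\mathbf F_2)$. Let $L_0$ be the $\mathbf F_2$-vector space with basis $1,x$ and, for $0\ne\alpha\in\pi$, let $L_\alpha$ be the $\mathbf F_2$-vector space with basis $y_\alpha,z_\alpha$; $L=\bigoplus_{\alpha\in\pi}L_\alpha$. The commutative multiplication $m$ has unit $1$ and, for distinct nonzero $\alpha,\beta$: $x x=0$, $x y_\alpha=x z_\alpha=0$, $y_\alpha z_\alpha=x$, $y_\alpha y_\alpha=z_\alpha z_\alpha=0$, $y_\alpha y_\beta=y_\alpha z_\beta=z_\alpha y_\beta=z_\alpha z_\beta=y_{\alpha+\beta}+z_{\alpha+\beta}$. The comultiplications $\Delta_{\alpha,\beta}\colon L_{\alpha+\beta}\to L_\alpha\otimes L_\beta$ are: $\Delta_{0,0}(1)=1\otimes x+x\otimes1$, $\Delta_{0,0}(x)=x\otimes x$; for $\alpha\neq0$, $\Delta_{\alpha,\alpha}(1)=y_\alpha\otimes z_\alpha+z_\alpha\otimes y_\alpha$, $\Delta_{\alpha,\alpha}(x)=0$, $\Delta_{0,\alpha}(y_\alpha)=x\otimes y_\alpha$, $\Delta_{0,\alpha}(z_\alpha)=x\otimes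 z_\alpha$, and $\Delta_{\alpha,0}$ is $\Delta_{0,\alpha}$ followed by the flip; for distinct nonzero $\alpha,\beta$, $\Delta_{\alpha,\beta}(y_{\alpha+\beta})=\Delta_{\alpha,\beta}(z_{\alpha+\beta})=y_\alpha\otimes y_\beta+y_\alpha\otimes z_\beta+z_\alpha\otimes y_\beta+z_\alpha\otimes z_\beta$. The remaining structure maps are $\varphi_\alpha=\mathrm{id}$, $\Phi=\mathrm{id}$, $\theta_\alpha=0$ for all $\alpha\in\pi$. **The homology.** Let $D$ have $n$ ordered crossings. At a crossing, the $0$-smoothing merges the two regions swept out by rotating the over-strand counterclockwise to the under-strand; the $1$-smoothing is the other one. For $\varepsilon\in\{0,1\}^n$ let $D_\varepsilon$ be the collection of disjoint circles in $F$ obtained by $\varepsilon_i$-smoothing the $i$-th crossing for each $i$, and $|\varepsilon|=\sum\varepsilon_i$. For the HQFT $(A,\tau)$ corresponding to $L$, $A(D_\varepsilon)$ is the tensor product over $\mathbf F_2$ of the spaces $L_{[\Gamma]}$ over the circles $\Gamma$ of $D_\varepsilon$, $[\Gamma]\in H_1(F;\mathbf F_2)$, and $$C^i_{(A,\tau)}(F,D)=\bigoplus_{|\varepsilon|=i+n_-(D)}A(D_\varepsilon).$$ The differential $d^i\colon C^i\to C^{i+1}$ has components $d_{\varepsilon\to\varepsilon'}\colon A(D_\varepsilon)\to A(D_{\varepsilon'})$, which vanish unless $\varepsilon,\varepsilon'$ differ in exactly one place $j$, with $\varepsilon_j=0,\varepsilon'_j=1$. In that case: if two circles of $D_\varepsilon$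 merge into one circle of $D_{\varepsilon'}$, $d_{\varepsilon\to\varepsilon'}$ is $m$ on the corresponding factors and the identity elsewhere; if a circle of $D_\varepsilon$ splits into two circles of classes $\alpha,\beta$, it is $\Delta_{\alpha,\beta}$ on the corresponding factor and the identity elsewhere; if a circle changes into a single circle, it is multiplication by $\theta_0=0$, i.e. zero. $H^*_{(A,\tau)}(F,D)$ is the cohomology of this complex. **Weak plus-adequacy.** Let $D_{\mathbf 0}$ be the smoothing in which all crossings of $D$ are $0$-smoothed. $(F,D)$ is weak plus-adequate if for every $\varepsilon\in\{0,1\}^n$ with $|\varepsilon|=1$, $D_\varepsilon$ is obtained from $D_{\mathbf 0}$ in one of the following ways: (i) two circles of $D_{\mathbf 0}$ merge into one circle of $D_\varepsilon$; (ii) a circle of $D_{\mathbf 0}$ which is zero in $H_1(F;\mathbf F_2)$ splits into two circles of $D_\varepsilon$, neither of which is zero in $H_1(F;\mathbf F_2)$; (iii) a circle of $D_{\mathbf 0}$ which is nonzero in $H_1(F;\mathbf F_2)$ splits into two circles of $D_\varepsilon$, neither of which is zero in $H_1(F;\mathbf F_2)$; (iv) a circle of $D_{\mathbf 0}$ changes into a single circle of $D_\varepsilon$ (the numbers of circles of $D_\varepsilon$ and $D_{\mathbf 0}$ are equal). *)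

theory Defs
  imports "HOL-Homology.Homology" "HOL-Complex_Analysis.Complex_Analysis" "HOL-Library.Z2"
begin

section \<open>Oriented compact surfaces\<close>

text \<open>
  A homeomorphism between plane open sets preserves orientation at \<open>z\<close> iff it maps small
  counterclockwise circles around \<open>z\<close> to loops of winding number \<open>1\<close> around the image of \<open>z\<close>.
\<close>

definition orientation_preserving_at :: "(complex \<Rightarrow> complex) \<Rightarrow> complex \<Rightarrow> bool" where
  "orientation_preserving_at h z \<longleftrightarrow>
     (\<exists>r0>0. \<forall>r. 0 < r \<and> r < r0 \<longrightarrow> winding_number (h \<circ> circlepath z r) (h z) = 1)"

definition half_plane :: "complex set" where
  "half_plane = {z. 0 \<le> Im z}"

definition chart :: "'a topology \<Rightarrow> 'a set \<Rightarrow> ('a \<Rightarrow> complex) \<Rightarrow> bool" where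
  "chart F U f \<longleftrightarrow>
     openin F U \<and>
     openin (top_of_set half_plane) (f ` U) \<and>
     homeomorphic_map (subtopology F U) (top_of_set (f ` U)) f"

text \<open>
  \<open>\<A>\<close> is an oriented atlas of the topological surface \<open>F\<close>. The surface may have boundary and
  need not be connected; orientations are compared at interior points. Second countability is
  automatic by compactness.
\<close>

definition oriented_compact_surface :: "'a topology \<Rightarrow> ('a set \<times> ('a \<Rightarrow> complex)) set \<Rightarrow> bool" where
  "oriented_compact_surface F \<A> \<longleftrightarrow>
     compact_space F \<and> Hausdorff_space F \<and>
     (\<forall>(U, f) \<in> \<A>. chart F U f) \<and>
     (\<Union>(U, f) \<in> \<A>. U) = topspace F \<and>
     (\<forall>(U, f) \<in> \<A>. \<forall>(V, g) \<in> \<A>. \<forall>p \<in> U \<inter> V.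
        0 < Im (f p) \<longrightarrow> orientation_preserving_at (g \<circ> inv_into U f) (f p))"


section \<open>Homology with coefficients in the field with two elements\<close>

text \<open>
  The singular chain complex of \<open>X\<close> with coefficients in \<open>\<int>/2\<close> is the integral chain
  complex reduced modulo 2. Its cycles and boundaries are represented by integral chains.
\<close>

definition mod2_cycles :: "nat \<Rightarrow> 'a topology \<Rightarrow> 'a chain set" where
  "mod2_cycles p X = {c. singular_chain p X c \<and> (\<exists>d. chain_boundary p c = frag_cmul 2 d)}"

definition mod2_boundaries :: "nat \<Rightarrow> 'a topology \<Rightarrow> 'a chain set" where
  "mod2_boundaries p X =
     {chain_boundary (Suc p) b + frag_cmul 2 c | b c.
        singular_chain (Suc p) X b \<and> singular_chain p X c}"

definition mod2_homology_group :: "nat \<Rightarrow> 'a topology \<Rightarrow> 'a chain set monoid" where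
  "mod2_homology_group p X =
     subgroup_generated (chain_group p X) (mod2_cycles p X) Mod mod2_boundaries p X"

definition mod2_homology_class :: "nat \<Rightarrow> 'a topology \<Rightarrow> 'a chain \<Rightarrow> 'a chain set" where
  "mod2_homology_class p X c =
     mod2_boundaries p X #>\<^bsub>subgroup_generated (chain_group p X) (mod2_cycles p X)\<^esub> c"

definition path_simplex :: "(real \<Rightarrow> 'a) \<Rightarrow> (nat \<Rightarrow> real) \<Rightarrow> 'a" where
  "path_simplex g = restrict (\<lambda>t. g (t 1)) (standard_simplex 1)"


section \<open>Oriented link diagrams\<close>

text \<open>
  A link diagram is a 4-valent graph embedded in the surface, possibly with additional
  crossingless closed components, together with over/under information and an orientation.

  \<^item> Crossing \<open>i < ncross D\<close> comes with a closed disc \<open>disc D i ` cball 0 1\<close>, parametrized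
    preserving the orientation, which meets the diagram in the two coordinate axes of the unit
    disc. The over-strand is the real axis and runs from \<open>-1\<close> to \<open>1\<close>. The under-strand is the
    imaginary axis; it runs from \<open>-\<i>\<close> to \<open>\<i>\<close> at a positive crossing and from \<open>\<i>\<close> to \<open>-\<i>\<close> at
    a negative one.
  \<^item> \<open>edge D i s\<close> is the arc of the diagram which leaves the disc of crossing \<open>i\<close> along the
    over-strand (if \<open>s\<close>) or the under-strand (if \<open>\<not> s\<close>) and ends when it next enters
    a crossing disc.
  \<^item> \<open>loop D k\<close>, for \<open>k < nloops D\<close>, are the components without crossings.
\<close>

record 'a diagram =
  ncross :: nat
  disc :: "nat \<Rightarrow> complex \<Rightarrow> 'a"
  positive :: "nat \<Rightarrow> bool"
  edge :: "nat \<Rightarrow> bool \<Rightarrow> real \<Rightarrow> 'a"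
  nloops :: nat
  loop :: "nat \<Rightarrow> real \<Rightarrow> 'a"

definition out_port :: "'a diagram \<Rightarrow> nat \<Rightarrow> bool \<Rightarrow> 'a" where
  "out_port D i s = disc D i (if s then 1 else if positive D i then \<i> else - \<i>)"

definition in_port :: "'a diagram \<Rightarrow> nat \<Rightarrow> bool \<Rightarrow> 'a" where
  "in_port D i s = disc D i (if s then - 1 else if positive D i then - \<i> else \<i>)"

definition oriented_link_diagram ::
    "'a topology \<Rightarrow> ('a set \<times> ('a \<Rightarrow> complex)) set \<Rightarrow> 'a diagram \<Rightarrow> bool" where
  "oriented_link_diagram F \<A> D \<longleftrightarrow>
     (\<forall>i<ncross D. embedding_map (top_of_set (cball 0 1)) F (disc D i) \<and>
        (\<forall>(U, f) \<in> \<A>. \<forall>z \<in> ball 0 1.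
           disc D i z \<in> U \<longrightarrow> orientation_preserving_at (f \<circ> disc D i) z)) \<and>
     (\<forall>i<ncross D. \<forall>j<ncross D. i \<noteq> j \<longrightarrow>
        disjnt (disc D i ` cball 0 1) (disc D j ` cball 0 1)) \<and>
     (\<forall>i<ncross D. \<forall>s. pathin F (edge D i s) \<and> inj_on (edge D i s) {0..1} \<and>
        edge D i s 0 = out_port D i s \<and>
        (\<exists>j<ncross D. \<exists>t. edge D i s 1 = in_port D j t)) \<and>
     (\<forall>i<ncross D. \<forall>s. \<forall>j<ncross D.
        disjnt (edge D i s ` {0<..<1}) (disc D j ` cball 0 1)) \<and>
     (\<forall>i<ncross D. \<forall>s. \<forall>j<ncross D. \<forall>t. (i, s) \<noteq> (j, t) \<longrightarrow>
        disjnt (edge D i s ` {0..1}) (edge D j t ` {0..1})) \<and>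
     (\<forall>k<nloops D. pathin F (loop D k) \<and> loop D k 0 = loop D k 1 \<and>
        inj_on (loop D k) {0..<1} \<and>
        (\<forall>l<nloops D. k \<noteq> l \<longrightarrow> disjnt (loop D k ` {0..1}) (loop D l ` {0..1})) \<and>
        (\<forall>i<ncross D. disjnt (loop D k ` {0..1}) (disc D i ` cball 0 1) \<and>
           (\<forall>s. disjnt (loop D k ` {0..1}) (edge D i s ` {0..1}))))"

definition nneg :: "'a diagram \<Rightarrow> nat" where
  "nneg D = card {i. i < ncross D \<and> \<not> positive D i}"


section \<open>Smoothings and their circles\<close>

text \<open>
  A vertex of the cube \<open>{0,1}\<^sup>n\<close> is represented by the set \<open>\<epsilon> \<subseteq> {..<n}\<close> of the 1-smoothed
  crossings. Rotating the over-strand (real axis) counterclockwise to the under-strand (imaginary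
  axis) sweeps out the first and third quadrants. The 0-smoothing merges them, so it connects
  \<open>1\<close> to \<open>-\<i>\<close> and \<open>-1\<close> to \<open>\<i>\<close>; the 1-smoothing connects \<open>1\<close> to \<open>\<i>\<close> and \<open>-1\<close> to \<open>-\<i>\<close>.
\<close>

definition smoothing_arc :: "bool \<Rightarrow> bool \<Rightarrow> real \<Rightarrow> complex" where
  "smoothing_arc one_smoothed s =
     (if one_smoothed then (if s then linepath 1 \<i> else linepath (- 1) (- \<i>))
      else (if s then linepath 1 (- \<i>) else linepath (- 1) \<i>))"

datatype piece = Edge nat bool | Loop nat | Smooth nat bool

definition pieces :: "'a diagram \<Rightarrow> piece set" where
  "pieces D = {Edge i s | i s. i < ncross D} \<union> {Loop k | k. k < nloops D}
     \<union> {Smooth i s | i s. i < ncross D}"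

fun piece_path :: "'a diagram \<Rightarrow> nat set \<Rightarrow> piece \<Rightarrow> real \<Rightarrow> 'a" where
  "piece_path D \<epsilon> (Edge i s) = edge D i s"
| "piece_path D \<epsilon> (Loop k) = loop D k"
| "piece_path D \<epsilon> (Smooth i s) = disc D i \<circ> smoothing_arc (i \<in> \<epsilon>) s"

definition smoothing :: "'a diagram \<Rightarrow> nat set \<Rightarrow> 'a set" where
  "smoothing D \<epsilon> = (\<Union>P \<in> pieces D. piece_path D \<epsilon> P ` {0..1})"

definition circles :: "'a topology \<Rightarrow> 'a diagram \<Rightarrow> nat set \<Rightarrow> 'a set set" where
  "circles F D \<epsilon> = connected_components_of (subtopology F (smoothing D \<epsilon>))"

text \<open>
  The fundamental class modulo 2 of a circle, pushed forward to \<open>F\<close>, is represented by the sum of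
  the arcs into which the circle is subdivided.
\<close>

definition circle_class :: "'a topology \<Rightarrow> 'a diagram \<Rightarrow> nat set \<Rightarrow> 'a set \<Rightarrow> 'a chain set" where
  "circle_class F D \<epsilon> \<Gamma> =
     mod2_homology_class 1 F
       (\<Sum>P \<in> {P \<in> pieces D. piece_path D \<epsilon> P ` {0..1} \<subseteq> \<Gamma>}.
          frag_of (path_simplex (piece_path D \<epsilon> P)))"

text \<open>
  Circles are sets of points, so the circles not touched by a change of smoothing belong to both
  collections.
\<close>

definition merges :: "'a topology \<Rightarrow> 'a diagram \<Rightarrow> nat set \<Rightarrow> nat set \<Rightarrow>
    'a set \<Rightarrow> 'a set \<Rightarrow> 'a set \<Rightarrow> bool" where
  "merges F D \<epsilon> \<epsilon>' \<Gamma>1 \<Gamma>2 \<Gamma> \<longleftrightarrow>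
     \<Gamma>1 \<noteq> \<Gamma>2 \<and> circles F D \<epsilon> - circles F D \<epsilon>' = {\<Gamma>1, \<Gamma>2} \<and>
     circles F D \<epsilon>' - circles F D \<epsilon> = {\<Gamma>}"

definition splits :: "'a topology \<Rightarrow> 'a diagram \<Rightarrow> nat set \<Rightarrow> nat set \<Rightarrow>
    'a set \<Rightarrow> 'a set \<Rightarrow> 'a set \<Rightarrow> bool" where
  "splits F D \<epsilon> \<epsilon>' \<Gamma> \<Gamma>1 \<Gamma>2 \<longleftrightarrow>
     \<Gamma>1 \<noteq> \<Gamma>2 \<and> circles F D \<epsilon> - circles F D \<epsilon>' = {\<Gamma>} \<and>
     circles F D \<epsilon>' - circles F D \<epsilon> = {\<Gamma>1, \<Gamma>2}"

definition changes :: "'a topology \<Rightarrow> 'a diagram \<Rightarrow> nat set \<Rightarrow> nat set \<Rightarrow>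
    'a set \<Rightarrow> 'a set \<Rightarrow> bool" where
  "changes F D \<epsilon> \<epsilon>' \<Gamma> \<Gamma>' \<longleftrightarrow>
     circles F D \<epsilon> - circles F D \<epsilon>' = {\<Gamma>} \<and> circles F D \<epsilon>' - circles F D \<epsilon> = {\<Gamma>'}"

definition weak_plus_adequate :: "'a topology \<Rightarrow> 'a diagram \<Rightarrow> bool" where
  "weak_plus_adequate F D \<longleftrightarrow>
     (\<forall>\<epsilon> \<subseteq> {..<ncross D}. card \<epsilon> = 1 \<longrightarrow>
        (\<exists>\<Gamma>1 \<Gamma>2 \<Gamma>. merges F D {} \<epsilon> \<Gamma>1 \<Gamma>2 \<Gamma>) \<or>
        (\<exists>\<Gamma> \<Gamma>1 \<Gamma>2. splits F D {} \<epsilon> \<Gamma> \<Gamma>1 \<Gamma>2 \<and>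
           circle_class F D {} \<Gamma> = \<one>\<^bsub>mod2_homology_group 1 F\<^esub> \<and>
           circle_class F D \<epsilon> \<Gamma>1 \<noteq> \<one>\<^bsub>mod2_homology_group 1 F\<^esub> \<and>
           circle_class F D \<epsilon> \<Gamma>2 \<noteq> \<one>\<^bsub>mod2_homology_group 1 F\<^esub>) \<or>
        (\<exists>\<Gamma> \<Gamma>1 \<Gamma>2. splits F D {} \<epsilon> \<Gamma> \<Gamma>1 \<Gamma>2 \<and>
           circle_class F D {} \<Gamma> \<noteq> \<one>\<^bsub>mod2_homology_group 1 F\<^esub> \<and>
           circle_class F D \<epsilon> \<Gamma>1 \<noteq> \<one>\<^bsub>mod2_homology_group 1 F\<^esub> \<and>
           circle_class F D \<epsilon> \<Gamma>2 \<noteq> \<one>\<^bsub>mod2_homology_group 1 F\<^esub>) \<or>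
        (\<exists>\<Gamma> \<Gamma>'. changes F D {} \<epsilon> \<Gamma> \<Gamma>'))"


section \<open>The extended crossed algebra\<close>

text \<open>
  The structure maps of a \<open>\<pi>\<close>-graded algebra over the field with two elements, given by matrices
  with respect to a homogeneous basis: \<open>xbasis \<alpha>\<close> is the basis of the summand of degree \<open>\<alpha>\<close>. A
  vector is its coefficient function, and a tensor product has the product basis. The action
  \<open>xphi \<alpha>\<close>, the involution \<open>xPhi\<close>, the multiplication, the comultiplications and the elements
  \<open>xtheta \<alpha>\<close> are the usual structure maps.
\<close>

record ('g, 'b) xalgebra =
  xbasis :: "'g \<Rightarrow> 'b set"
  xunit :: "'b \<Rightarrow> bit"
  xmult :: "'b \<Rightarrow> 'b \<Rightarrow> 'b \<Rightarrow> bit"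
  xcomult :: "'g \<Rightarrow> 'g \<Rightarrow> 'b \<Rightarrow> 'b \<times> 'b \<Rightarrow> bit"
  xphi :: "'g \<Rightarrow> 'b \<Rightarrow> 'b \<Rightarrow> bit"
  xPhi :: "'b \<Rightarrow> 'b \<Rightarrow> bit"
  xtheta :: "'g \<Rightarrow> 'b \<Rightarrow> bit"

definition basis_sum :: "'b set \<Rightarrow> 'b \<Rightarrow> bit" where
  "basis_sum S = (\<lambda>b. of_bool (b \<in> S))"

datatype 'g L_gen = L_one | L_x | L_y 'g | L_z 'g

definition L_basis :: "'g monoid \<Rightarrow> 'g \<Rightarrow> 'g L_gen set" where
  "L_basis \<pi> \<alpha> = (if \<alpha> = \<one>\<^bsub>\<pi>\<^esub> then {L_one, L_x} else {L_y \<alpha>, L_z \<alpha>})"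

fun L_mult :: "'g monoid \<Rightarrow> 'g L_gen \<Rightarrow> 'g L_gen \<Rightarrow> 'g L_gen \<Rightarrow> bit" where
  "L_mult \<pi> L_one b = basis_sum {b}"
| "L_mult \<pi> b L_one = basis_sum {b}"
| "L_mult \<pi> L_x b = basis_sum {}"
| "L_mult \<pi> b L_x = basis_sum {}"
| "L_mult \<pi> (L_y \<alpha>) (L_y \<beta>) = basis_sum (if \<alpha> = \<beta> then {} else {L_y (\<alpha> \<otimes>\<^bsub>\<pi>\<^esub> \<beta>), L_z (\<alpha> \<otimes>\<^bsub>\<pi>\<^esub> \<beta>)})"
| "L_mult \<pi> (L_z \<alpha>) (L_z \<beta>) = basis_sum (if \<alpha> = \<beta> then {} else {L_y (\<alpha> \<otimes>\<^bsub>\<pi>\<^esub> \<beta>), L_z (\<alpha> \<otimes>\<^bsub>\<pi>\<^esub> \<beta>)})"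
| "L_mult \<pi> (L_y \<alpha>) (L_z \<beta>) = basis_sum (if \<alpha> = \<beta> then {L_x} else {L_y (\<alpha> \<otimes>\<^bsub>\<pi>\<^esub> \<beta>), L_z (\<alpha> \<otimes>\<^bsub>\<pi>\<^esub> \<beta>)})"
| "L_mult \<pi> (L_z \<alpha>) (L_y \<beta>) = basis_sum (if \<alpha> = \<beta> then {L_x} else {L_y (\<alpha> \<otimes>\<^bsub>\<pi>\<^esub> \<beta>), L_z (\<alpha> \<otimes>\<^bsub>\<pi>\<^esub> \<beta>)})"

text \<open>The argument of \<open>L_comult \<pi> \<alpha> \<beta>\<close> is meant to be a basis vector of degree \<open>\<alpha> \<otimes> \<beta>\<close>.\<close>

definition L_comult :: "'g monoid \<Rightarrow> 'g \<Rightarrow> 'g \<Rightarrow> 'g L_gen \<Rightarrow> 'g L_gen \<times> 'g L_gen \<Rightarrow> bit" where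
  "L_comult \<pi> \<alpha> \<beta> b = basis_sum
     (if \<alpha> = \<one>\<^bsub>\<pi>\<^esub> \<and> \<beta> = \<one>\<^bsub>\<pi>\<^esub> then (if b = L_one then {(L_one, L_x), (L_x, L_one)} else {(L_x, L_x)})
      else if \<alpha> = \<one>\<^bsub>\<pi>\<^esub> then {(L_x, b)}
      else if \<beta> = \<one>\<^bsub>\<pi>\<^esub> then {(b, L_x)}
      else if \<alpha> = \<beta> then (if b = L_one then {(L_y \<alpha>, L_z \<alpha>), (L_z \<alpha>, L_y \<alpha>)} else {})
      else {(L_y \<alpha>, L_y \<beta>), (L_y \<alpha>, L_z \<beta>), (L_z \<alpha>, L_y \<beta>), (L_z \<alpha>, L_z \<beta>)})"

definition L_algebra :: "'g monoid \<Rightarrow> ('g, 'g L_gen) xalgebra" where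
  "L_algebra \<pi> =
     \<lparr>xbasis = L_basis \<pi>, xunit = basis_sum {L_one}, xmult = L_mult \<pi>, xcomult = L_comult \<pi>,
      xphi = (\<lambda>\<alpha> b. basis_sum {b}), xPhi = (\<lambda>b. basis_sum {b}), xtheta = (\<lambda>\<alpha>. basis_sum {})\<rparr>"


section \<open>The complex of a diagram\<close>

text \<open>
  Basis of \<open>A(D\<^sub>\<epsilon>)\<close>, the tensor product of the summands of \<open>L\<close> over the circles
  of \<open>D\<^sub>\<epsilon>\<close>: a basis vector of the appropriate degree for each circle.
\<close>

definition state_basis :: "('a chain set, 'b) xalgebra \<Rightarrow> 'a topology \<Rightarrow> 'a diagram \<Rightarrow> nat set
    \<Rightarrow> ('a set \<Rightarrow> 'b) set" where
  "state_basis L F D \<epsilon> = (\<Pi>\<^sub>E \<Gamma> \<in> circles F D \<epsilon>. xbasis L (circle_class F D \<epsilon> \<Gamma>))"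

definition cochain_basis :: "('a chain set, 'b) xalgebra \<Rightarrow> 'a topology \<Rightarrow> 'a diagram \<Rightarrow> int
    \<Rightarrow> (nat set \<times> ('a set \<Rightarrow> 'b)) set" where
  "cochain_basis L F D i =
     (SIGMA \<epsilon> : {\<epsilon>. \<epsilon> \<subseteq> {..<ncross D} \<and> int (card \<epsilon>) = i + int (nneg D)}. state_basis L F D \<epsilon>)"

definition cochain_group :: "('a chain set, 'b) xalgebra \<Rightarrow> 'a topology \<Rightarrow> 'a diagram \<Rightarrow> int
    \<Rightarrow> (nat set \<times> ('a set \<Rightarrow> 'b) \<Rightarrow> bit) monoid" where
  "cochain_group L F D i =
     \<lparr>carrier = {v. \<forall>e. e \<notin> cochain_basis L F D i \<longrightarrow> v e = 0},
      monoid.mult = (\<lambda>u v e. u e + v e), one = (\<lambda>e. 0)\<rparr>"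

text \<open>
  The matrix entry of \<open>d\<^bsub>\<epsilon>\<rightarrow>\<epsilon>'\<^esub>\<close> from the basis vector \<open>b\<close> of \<open>A(D\<^sub>\<epsilon>)\<close>
  to the basis vector \<open>b'\<close> of \<open>A(D\<^bsub>\<epsilon>'\<^esub>)\<close>; entries lie in \<open>{0, 1}\<close>. In the case of
  a merge (a split) the order of \<open>\<Gamma>1\<close> and \<open>\<Gamma>2\<close> is immaterial, since the multiplication is
  commutative and the comultiplications are compatible with the flip.
\<close>

definition edge_entry :: "('a chain set, 'b) xalgebra \<Rightarrow> 'a topology \<Rightarrow> 'a diagram \<Rightarrow> nat set
    \<Rightarrow> nat set \<Rightarrow> ('a set \<Rightarrow> 'b) \<Rightarrow> ('a set \<Rightarrow> 'b) \<Rightarrow> bit" where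
  "edge_entry L F D \<epsilon> \<epsilon>' b b' = of_bool
     ((\<exists>j. j < ncross D \<and> j \<notin> \<epsilon> \<and> \<epsilon>' = insert j \<epsilon>) \<and>
      (\<forall>\<Gamma> \<in> circles F D \<epsilon> \<inter> circles F D \<epsilon>'. b' \<Gamma> = b \<Gamma>) \<and>
      ((\<exists>\<Gamma>1 \<Gamma>2 \<Gamma>. merges F D \<epsilon> \<epsilon>' \<Gamma>1 \<Gamma>2 \<Gamma> \<and> xmult L (b \<Gamma>1) (b \<Gamma>2) (b' \<Gamma>) = 1) \<or>
       (\<exists>\<Gamma> \<Gamma>1 \<Gamma>2. splits F D \<epsilon> \<epsilon>' \<Gamma> \<Gamma>1 \<Gamma>2 \<and>
          xcomult L (circle_class F D \<epsilon>' \<Gamma>1) (circle_class F D \<epsilon>' \<Gamma>2) (b \<Gamma>) (b' \<Gamma>1, b' \<Gamma>2) = 1) \<or>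
       (\<exists>\<Gamma> \<Gamma>'. changes F D \<epsilon> \<epsilon>' \<Gamma> \<Gamma>' \<and>
          (\<Sum>t \<in> xbasis L \<one>\<^bsub>mod2_homology_group 1 F\<^esub>.
             xtheta L \<one>\<^bsub>mod2_homology_group 1 F\<^esub> t * xmult L t (b \<Gamma>) (b' \<Gamma>')) = 1)))"

definition differential :: "('a chain set, 'b) xalgebra \<Rightarrow> 'a topology \<Rightarrow> 'a diagram \<Rightarrow> int
    \<Rightarrow> (nat set \<times> ('a set \<Rightarrow> 'b) \<Rightarrow> bit) \<Rightarrow> nat set \<times> ('a set \<Rightarrow> 'b) \<Rightarrow> bit" where
  "differential L F D i v = (\<lambda>(\<epsilon>', b').
     if (\<epsilon>', b') \<in> cochain_basis L F D (i + 1)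
     then \<Sum>(\<epsilon>, b) \<in> cochain_basis L F D i. v (\<epsilon>, b) * edge_entry L F D \<epsilon> \<epsilon>' b b'
     else 0)"

definition cocycles :: "('a chain set, 'b) xalgebra \<Rightarrow> 'a topology \<Rightarrow> 'a diagram \<Rightarrow> int
    \<Rightarrow> (nat set \<times> ('a set \<Rightarrow> 'b) \<Rightarrow> bit) set" where
  "cocycles L F D i =
     {v \<in> carrier (cochain_group L F D i). differential L F D i v = (\<lambda>e. 0)}"

definition coboundaries :: "('a chain set, 'b) xalgebra \<Rightarrow> 'a topology \<Rightarrow> 'a diagram \<Rightarrow> int
    \<Rightarrow> (nat set \<times> ('a set \<Rightarrow> 'b) \<Rightarrow> bit) set" where
  "coboundaries L F D i = differential L F D (i - 1) ` carrier (cochain_group L F D (i - 1))"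

definition link_cohomology :: "('a chain set, 'b) xalgebra \<Rightarrow> 'a topology \<Rightarrow> 'a diagram \<Rightarrow> int
    \<Rightarrow> (nat set \<times> ('a set \<Rightarrow> 'b) \<Rightarrow> bit) set monoid" where
  "link_cohomology L F D i =
     subgroup_generated (cochain_group L F D i) (cocycles L F D i) Mod coboundaries L F D i"

end

theory Submission
  imports Defs
begin

text \<open>
  The lowest cochain group is the space \<open>A(D\<^sub>0)\<close> of the smoothing in which all crossings are
  0-smoothed, and there is nothing below it. Its cohomology is therefore the common kernel of the
  maps \<open>d\<^sub>j\<close> belonging to the changes of smoothing at a single crossing \<open>j\<close>, and the theorem is
  a matter of comparing these kernels.

  Suppose that some \<open>d\<^sub>j\<close> splits a circle of class \<open>\<alpha>\<close> into two circles, one of which is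
  null-homologous. Then the other one has class \<open>\<alpha>\<close>, and \<open>d\<^sub>j\<close> is the comultiplication
  \<open>L\<^sub>\<alpha> \<rightarrow> L\<^sub>0 \<otimes> L\<^sub>\<alpha>\<close>. Reading off the coefficient of \<open>x\<close> in the first factor recovers the
  vector that was split (\<open>L_comult_counit\<close>), so \<open>d\<^sub>j\<close> is injective and the cohomology vanishes
  (\<open>cocycle_eq_0_if_splits_off_null_circle\<close>).

  Suppose that no change of smoothing splits off a null-homologous circle. Then the tensor product
  of the vectors \<open>x\<close> over the null-homologous circles and \<open>y\<^sub>\<alpha> + z\<^sub>\<alpha>\<close> over the circles of class
  \<open>\<alpha> \<noteq> 0\<close> is a nonzero cocycle (\<open>nonzero_cocycle_if_weak_plus_adequate\<close>). On the terms
  of its expansion, the maps of merges and splits do not see an exchange of \<open>y\<close> and \<open>z\<close> in all the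
  factors which they involve, so the contributions to the image cancel in pairs as soon as one of
  these factors has nonzero class. If all of them have class zero, then the terms are mapped to zero
  because \<open>x x = 0\<close> and \<open>\<Delta>\<^bsub>\<beta>,\<beta>\<^esub>(x) = 0\<close> for \<open>\<beta> \<noteq> 0\<close>.

  This uses two topological facts. The first is that a change of smoothing at one crossing is a
  merge, a split, or a replacement of one circle by one circle, whose map is zero because
  \<open>\<theta>\<^sub>0 = 0\<close> (\<open>merges_or_splits_or_changes\<close>). Both smoothings arise from the same
  space by adding two arcs in a disc, and the four ends of these arcs cannot lie in four different
  components of this space: by a count of degrees, each component contains an even number of
  them (\<open>even_ports\<close>). The second is the additivity of homology classes under splits. The sum of
  all circles of a smoothing is the sum of all its arcs; a change of smoothing replaces two
  opposite sides of a square in a disc by the other two, and thus alters this sum by a boundary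
  (\<open>smoothing_change_homologous\<close>).
\<close>

section \<open>The arcs in a crossing disc\<close>

lemma smoothing_arc_in_cball: "smoothing_arc b s ` {0..1} \<subseteq> cball 0 1"
proof -
  have "path_image (linepath x y) \<subseteq> cball 0 1" if "norm x \<le> 1" "norm y \<le> 1" for x y :: complex
    using that by (simp add: closed_segment_subset)
  then show ?thesis
    by (auto simp: smoothing_arc_def path_image_def image_subset_iff)
qed

lemma pathin_smoothing_arc: "pathin (top_of_set (cball 0 1)) (smoothing_arc b s)"
  using smoothing_arc_in_cball[of b s]
  by (auto simp: pathin_def smoothing_arc_def image_subset_iff intro!: continuous_intros)

text \<open>
  Each arc lies in a quadrant of its own, which is how the arcs of the two smoothings are
  told apart.
\<close>

lemma smoothing_arc_quadrant:
  assumes "t \<in> {0..1}"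
  shows "(if s then 0 \<le> Re (smoothing_arc b s t) else Re (smoothing_arc b s t) \<le> 0) \<and>
    (if s = b then 0 \<le> Im (smoothing_arc b s t) else Im (smoothing_arc b s t) \<le> 0)"
  using assms by (auto simp: smoothing_arc_def linepath_def)

text \<open>
  Midpoints witness that a circle through a crossing disc belongs to one of the two
  smoothings only.
\<close>

lemma smoothing_arc_midpoint: "smoothing_arc b s (1/2) \<notin> smoothing_arc (\<not> b) t ` {0..1}"
proof -
  have mid: "Re (smoothing_arc b s (1/2)) = (if s then 1/2 else -1/2)"
    "Im (smoothing_arc b s (1/2)) = (if s = b then 1/2 else -1/2)"
    by (auto simp: smoothing_arc_def linepath_def)
  show ?thesis
  proof
    assume "smoothing_arc b s (1/2) \<in> smoothing_arc (\<not> b) t ` {0..1}"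
    then obtain u where "u \<in> {0..1}" "smoothing_arc b s (1/2) = smoothing_arc (\<not> b) t u" by blast
    then show False
      using smoothing_arc_quadrant[of u t "\<not> b"] mid by (auto split: if_splits)
  qed
qed

lemma port_in_arcs:
  "\<exists>s. \<exists>t\<in>{0..1}. smoothing_arc b s t = z" if "z \<in> {1, -1, \<i>, -\<i>}"
proof -
  have "smoothing_arc b s 0 = (if s then 1 else -1)"
     "smoothing_arc b s 1 = (if s = b then \<i> else -\<i>)" for s
    by (auto simp: smoothing_arc_def linepath_def)
  then have "z \<in> {smoothing_arc b True 0, smoothing_arc b False 0, smoothing_arc b b 1, smoothing_arc b (\<not> b) 1}"
    using that by auto
  moreover have "(0::real) \<in> {0..1}" "(1::real) \<in> {0..1}" by auto
  ultimately show ?thesis by blast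
qed

section \<open>Circles of a smoothing\<close>

lemma clopen_connected_in_connected_components_of:
  assumes "connectedin X K" "K \<noteq> {}" "openin X K" "closedin X K"
  shows "K \<in> connected_components_of X"
proof -
  obtain x where x: "x \<in> K" using assms(2) by blast
  have "connected_component_of_set X x = K"
  proof
    show "connected_component_of_set X x \<subseteq> K"
      using connectedin_clopen_cases[OF connectedin_connected_component_of assms(4,3), of x] x
        connected_component_of_maximal[OF assms(1) x]
      by (auto simp: disjnt_def)
    show "K \<subseteq> connected_component_of_set X x"
      by (rule connected_component_of_maximal[OF assms(1) x])
  qed
  moreover have "x \<in> topspace X" using x assms(3) openin_subset by blast
  ultimately show ?thesis
    using connected_component_in_connected_components_of by metis
qed

text \<open>
  A link diagram as a union of arcs in a Hausdorff space. The smoothings, their circles and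
  the homology classes of these are governed by the way in which the edges and loops meet
  the crossing discs.
\<close>

locale link_diagram =
  fixes F :: "'a topology" and D :: "'a diagram"
  assumes Hausdorff: "Hausdorff_space F"
    and disc_embedding: "i < ncross D \<Longrightarrow> embedding_map (top_of_set (cball 0 1)) F (disc D i)"
    and disc_disjoint: "\<lbrakk>i < ncross D; j < ncross D; i \<noteq> j\<rbrakk> \<Longrightarrow>
        disjnt (disc D i ` cball 0 1) (disc D j ` cball 0 1)"
    and edge_path: "i < ncross D \<Longrightarrow> pathin F (edge D i s)"
    and edge_start: "i < ncross D \<Longrightarrow> edge D i s 0 = out_port D i s"
    and edge_finish: "i < ncross D \<Longrightarrow> \<exists>j<ncross D. \<exists>t. edge D i s 1 = in_port D j t"
    and edge_interior: "\<lbrakk>i < ncross D; j < ncross D\<rbrakk> \<Longrightarrow>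
        disjnt (edge D i s ` {0<..<1}) (disc D j ` cball 0 1)"
    and edge_disjoint: "\<lbrakk>i < ncross D; j < ncross D; (i, s) \<noteq> (j, t)\<rbrakk> \<Longrightarrow>
        disjnt (edge D i s ` {0..1}) (edge D j t ` {0..1})"
    and loop_path: "k < nloops D \<Longrightarrow> pathin F (loop D k)"
    and loop_disc: "\<lbrakk>k < nloops D; i < ncross D\<rbrakk> \<Longrightarrow>
        disjnt (loop D k ` {0..1}) (disc D i ` cball 0 1)"
begin

lemma disc_continuous: "i < ncross D \<Longrightarrow> continuous_map (top_of_set (cball 0 1)) F (disc D i)"
  using continuous_map_into_fulltopology[OF homeomorphic_imp_continuous_map]
    disc_embedding[of i, unfolded embedding_map_def] by metis

lemma disc_inj: "i < ncross D \<Longrightarrow> inj_on (disc D i) (cball 0 1)"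
  using disc_embedding[of i] by (simp add: embedding_map_def homeomorphic_map_def)

lemma closedin_disc: assumes "i < ncross D" shows "closedin F (disc D i ` cball 0 1)"
proof -
  have "compactin (top_of_set (cball 0 1)) (cball (0::complex) 1)"
    by (simp add: compactin_subtopology compactin_euclidean_iff)
  then show ?thesis
    using Hausdorff compactin_imp_closedin image_compactin disc_continuous[OF assms] by blast
qed

lemma pathin_piece_path: "P \<in> pieces D \<Longrightarrow> pathin F (piece_path D \<epsilon> P)"
  using pathin_compose[OF pathin_smoothing_arc disc_continuous]
  by (auto simp: pieces_def edge_path loop_path)

lemma finite_pieces [simp]: "finite (pieces D)"
proof -
  have "pieces D \<subseteq> (\<lambda>(i,s). Edge i s) ` ({..<ncross D} \<times> UNIV) \<union> Loop ` {..<nloops D}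
      \<union> (\<lambda>(i,s). Smooth i s) ` ({..<ncross D} \<times> UNIV)"
    by (auto simp: pieces_def)
  then show ?thesis by (rule finite_subset) auto
qed

lemma piece_in_smoothing: "P \<in> pieces D \<Longrightarrow> piece_path D \<epsilon> P ` {0..1} \<subseteq> smoothing D \<epsilon>"
  by (auto simp: smoothing_def)

lemma smoothing_subset: "smoothing D \<epsilon> \<subseteq> topspace F"
  using pathin_piece_path path_image_subset_topspace[of F] unfolding smoothing_def by fastforce

lemma topspace_Int_smoothing [simp]: "topspace F \<inter> smoothing D \<epsilon> = smoothing D \<epsilon>"
  using smoothing_subset by blast

lemma closedin_smoothing: "closedin F (smoothing D \<epsilon>)"
  unfolding smoothing_def
proof (intro closedin_Union)
  show "closedin F T" if "T \<in> (\<lambda>P. piece_path D \<epsilon> P ` {0..1}) ` pieces D" for T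
    using that by (auto intro!: compactin_imp_closedin[OF Hausdorff] compactin_path_image pathin_piece_path)
qed simp

lemma connectedin_piece:
  "P \<in> pieces D \<Longrightarrow> connectedin (subtopology F (smoothing D \<epsilon>)) (piece_path D \<epsilon> P ` {0..1})"
  using piece_in_smoothing pathin_piece_path connectedin_path_image
  by (metis connectedin_subtopology)

lemma piece_circle_cases:
  assumes "\<Gamma> \<in> circles F D \<epsilon>" "P \<in> pieces D"
  shows "piece_path D \<epsilon> P ` {0..1} \<subseteq> \<Gamma> \<or> disjnt \<Gamma> (piece_path D \<epsilon> P ` {0..1})"
  using connected_components_of_maximal[OF _ connectedin_piece[OF assms(2), of \<epsilon>], of \<Gamma>] assms(1)
  unfolding circles_def by blast

lemma circles_disjoint:
  "\<lbrakk>\<Gamma> \<in> circles F D \<epsilon>; \<Gamma>' \<in> circles F D \<epsilon>; p \<in> \<Gamma>; p \<in> \<Gamma>'\<rbrakk> \<Longrightarrow> \<Gamma> = \<Gamma>'"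
  using connected_components_of_overlap[of \<Gamma> _ \<Gamma>'] unfolding circles_def by blast

lemma Union_circles: "\<Union>(circles F D \<epsilon>) = smoothing D \<epsilon>"
  unfolding circles_def by (simp add: Union_connected_components_of)

lemma ex1_circle_of_piece:
  assumes "P \<in> pieces D"
  shows "\<exists>!\<Gamma>. \<Gamma> \<in> circles F D \<epsilon> \<and> piece_path D \<epsilon> P ` {0..1} \<subseteq> \<Gamma>"
proof (rule ex_ex1I)
  have 0: "piece_path D \<epsilon> P 0 \<in> piece_path D \<epsilon> P ` {0..1}" by simp
  then have "piece_path D \<epsilon> P 0 \<in> \<Union>(circles F D \<epsilon>)"
    unfolding Union_circles using piece_in_smoothing[OF assms] by (rule rev_subsetD)
  then obtain \<Gamma> where \<Gamma>: "\<Gamma> \<in> circles F D \<epsilon>" "piece_path D \<epsilon> P 0 \<in> \<Gamma>"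
    by (rule UnionE)
  then have "piece_path D \<epsilon> P ` {0..1} \<subseteq> \<Gamma>"
    using piece_circle_cases[OF \<Gamma>(1) assms] 0 unfolding disjnt_def by blast
  with \<Gamma> show "\<exists>\<Gamma>. \<Gamma> \<in> circles F D \<epsilon> \<and> piece_path D \<epsilon> P ` {0..1} \<subseteq> \<Gamma>" by blast
  show "\<Gamma> = \<Gamma>'"
    if "\<Gamma> \<in> circles F D \<epsilon> \<and> piece_path D \<epsilon> P ` {0..1} \<subseteq> \<Gamma>"
      "\<Gamma>' \<in> circles F D \<epsilon> \<and> piece_path D \<epsilon> P ` {0..1} \<subseteq> \<Gamma>'" for \<Gamma> \<Gamma>'
    using that 0 circles_disjoint[of \<Gamma> \<epsilon> \<Gamma>'] by blast
qed

lemma circle_contains_piece: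
  assumes "\<Gamma> \<in> circles F D \<epsilon>"
  shows "\<exists>P\<in>pieces D. piece_path D \<epsilon> P ` {0..1} \<subseteq> \<Gamma>"
proof -
  have "\<Gamma> \<noteq> {}"
    using assms nonempty_connected_components_of unfolding circles_def by blast
  then obtain p where p: "p \<in> \<Gamma>" by blast
  then have "p \<in> smoothing D \<epsilon>" using assms Union_circles by blast
  then obtain P where P: "P \<in> pieces D" "p \<in> piece_path D \<epsilon> P ` {0..1}"
    unfolding smoothing_def by blast
  have "piece_path D \<epsilon> P ` {0..1} \<subseteq> \<Gamma>"
    using piece_circle_cases[OF assms P(1)] p P(2) unfolding disjnt_def by blast
  with P(1) show ?thesis by blast
qed

text \<open>Every circle contains one of the finitely many pieces, and no piece lies in two circles.\<close>

lemma finite_circles [simp]: "finite (circles F D \<epsilon>)"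
proof -
  let ?f = "\<lambda>P. THE \<Gamma>. \<Gamma> \<in> circles F D \<epsilon> \<and> piece_path D \<epsilon> P ` {0..1} \<subseteq> \<Gamma>"
  have "circles F D \<epsilon> \<subseteq> ?f ` pieces D"
  proof
    fix \<Gamma> assume \<Gamma>: "\<Gamma> \<in> circles F D \<epsilon>"
    then obtain P where P: "P \<in> pieces D" "piece_path D \<epsilon> P ` {0..1} \<subseteq> \<Gamma>"
      using circle_contains_piece by blast
    then have "?f P = \<Gamma>"
      using ex1_circle_of_piece[OF P(1), of \<epsilon>] \<Gamma> by (intro the1_equality) auto
    then show "\<Gamma> \<in> ?f ` pieces D" using P(1) by blast
  qed
  then show ?thesis by (rule finite_subset) simp
qed

lemma out_port_cases: "\<exists>z\<in>{1, -1, \<i>, -\<i>}. out_port D i s = disc D i z"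
  and in_port_cases: "\<exists>z\<in>{1, -1, \<i>, -\<i>}. in_port D i s = disc D i z"
  by (auto simp: out_port_def in_port_def)

lemma disc_image_unique:
  assumes "i < ncross D" "j < ncross D" "p \<in> disc D i ` cball 0 1" "p \<in> disc D j ` cball 0 1"
  shows "i = j"
proof (rule ccontr)
  assume "i \<noteq> j"
  then show False
    using disc_disjoint[OF assms(1,2)] assms(3,4) unfolding disjnt_iff by blast
qed

text \<open>
  Edges meet a crossing disc in ports only, and the ports are the ends of the two arcs.
\<close>

lemma smoothing_Int_disc:
  assumes "j < ncross D" "p \<in> smoothing D \<epsilon>" "p \<in> disc D j ` cball 0 1"
  shows "\<exists>s. p \<in> piece_path D \<epsilon> (Smooth j s) ` {0..1}"
proof -
  have port: "\<exists>s. p \<in> piece_path D \<epsilon> (Smooth j s) ` {0..1}"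
    if i: "i < ncross D" and p: "p = disc D i z" and z: "z \<in> {1, -1, \<i>, -\<i>}" for i z
  proof -
    have "z \<in> cball 0 1" using z by auto
    then have "p \<in> disc D i ` cball 0 1" using p by blast
    then have "i = j" using disc_image_unique[OF i assms(1)] assms(3) by blast
    obtain s t where "t \<in> {0..1}" "smoothing_arc (j \<in> \<epsilon>) s t = z"
      using port_in_arcs[OF z] by blast
    then have "p = piece_path D \<epsilon> (Smooth j s) t" using p \<open>i = j\<close> by simp
    then show ?thesis using \<open>t \<in> {0..1}\<close> by blast
  qed
  obtain P t where P: "P \<in> pieces D" "t \<in> {0..1}" "p = piece_path D \<epsilon> P t"
    using assms unfolding smoothing_def by blast
  show ?thesis
  proof (cases P)
    case (Edge i s)
    then have i: "i < ncross D" using P by (auto simp: pieces_def)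
    have p: "p = edge D i s t" using P(3) Edge by simp
    have "t \<notin> {0<..<1}"
      using edge_interior[OF i assms(1), of s] assms(3) p unfolding disjnt_iff by blast
    then have "t = 0 \<or> t = 1" using P(2) by auto
    then show ?thesis
    proof
      assume "t = 0"
      then have "p = out_port D i s" using p edge_start[OF i] by simp
      then show ?thesis using out_port_cases[of i s] port[OF i] by blast
    next
      assume "t = 1"
      then obtain k u where "k < ncross D" "p = in_port D k u"
        using p edge_finish[OF i, of s] by blast
      then show ?thesis using in_port_cases[of k u] port by blast
    qed
  next
    case (Loop k)
    then have k: "k < nloops D" using P by (auto simp: pieces_def)
    have "p \<in> loop D k ` {0..1}" using P(2,3) Loop by auto
    then show ?thesis using loop_disc[OF k assms(1)] assms(3) unfolding disjnt_iff by blast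
  next
    case (Smooth i s)
    then have i: "i < ncross D" using P by (auto simp: pieces_def)
    have "smoothing_arc (i \<in> \<epsilon>) s t \<in> cball 0 1" using P(2) smoothing_arc_in_cball by blast
    moreover have "p = disc D i (smoothing_arc (i \<in> \<epsilon>) s t)" using P(3) Smooth by simp
    ultimately have "i = j" using disc_image_unique[OF i assms(1) _ assms(3)] by blast
    then show ?thesis using P(2,3) Smooth by blast
  qed
qed

lemma piece_path_cong:
  assumes "\<epsilon> - {j} = \<epsilon>' - {j}" "\<forall>s. P \<noteq> Smooth j s"
  shows "piece_path D \<epsilon> P = piece_path D \<epsilon>' P"
proof (cases P)
  case (Smooth i s)
  then have "i \<in> \<epsilon> \<longleftrightarrow> i \<in> \<epsilon>'" using assms by blast
  then show ?thesis using Smooth by simp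
qed auto

lemma smooth_piece_in_disc: "piece_path D \<epsilon> (Smooth j s) ` {0..1} \<subseteq> disc D j ` cball 0 1"
  using smoothing_arc_in_cball by fastforce

lemma smoothing_Diff_disc:
  assumes "\<epsilon> - {j} = \<epsilon>' - {j}"
  shows "smoothing D \<epsilon> - disc D j ` cball 0 1 = smoothing D \<epsilon>' - disc D j ` cball 0 1"
proof -
  have "p \<in> smoothing D \<delta>'"
    if \<delta>: "\<delta> - {j} = \<delta>' - {j}" and p: "p \<in> smoothing D \<delta>" "p \<notin> disc D j ` cball 0 1" for \<delta> \<delta>' p
  proof -
    obtain P where P: "P \<in> pieces D" "p \<in> piece_path D \<delta> P ` {0..1}"
      using p(1) unfolding smoothing_def by blast
    then have "\<forall>s. P \<noteq> Smooth j s" using p(2) smooth_piece_in_disc by blast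
    then show ?thesis using piece_path_cong[OF \<delta>] P unfolding smoothing_def by auto
  qed
  then show ?thesis using assms by (intro equalityI subsetI) (metis Diff_iff)+
qed

text \<open>
  As a smoothing has only finitely many circles, each of them is open and closed in it. A
  circle which avoids the crossing disc remains so when the smoothing is changed inside the
  disc.
\<close>

lemma circle_away_from_disc:
  assumes j: "j < ncross D" and \<epsilon>: "\<epsilon> - {j} = \<epsilon>' - {j}"
    and K: "K \<in> circles F D \<epsilon>" "K \<inter> disc D j ` cball 0 1 = {}"
  shows "K \<in> circles F D \<epsilon>'"
  unfolding circles_def
proof (rule clopen_connected_in_connected_components_of)
  let ?B = "disc D j ` cball 0 1"
  note C = K(1)[unfolded circles_def]
  have sub: "K \<subseteq> smoothing D \<epsilon>" using K(1) Union_circles by blast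
  then have sub': "K \<subseteq> smoothing D \<epsilon>'" using K(2) smoothing_Diff_disc[OF \<epsilon>] by blast
  show "connectedin (subtopology F (smoothing D \<epsilon>')) K"
    using connectedin_connected_components_of[OF C] sub' by (simp add: connectedin_subtopology)
  show "K \<noteq> {}" using nonempty_connected_components_of[OF C] .
  have "closedin F K"
    using closedin_connected_components_of[OF C] closedin_closed_subtopology[OF closedin_smoothing]
    by blast
  then show "closedin (subtopology F (smoothing D \<epsilon>')) K"
    using closedin_closed_subtopology[OF closedin_smoothing] sub' by blast
  have "openin (subtopology F (smoothing D \<epsilon>)) K"
    using open_in_finite_connected_components[OF _ C] finite_circles unfolding circles_def by blast
  then obtain U where U: "openin F U" "K = U \<inter> smoothing D \<epsilon>"
    unfolding openin_subtopology by blast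
  have "openin F (U - ?B)" using U(1) closedin_disc[OF j] by (rule openin_diff)
  moreover have "K = (U - ?B) \<inter> smoothing D \<epsilon>'"
    using U(2) K(2) smoothing_Diff_disc[OF \<epsilon>] by blast
  ultimately show "openin (subtopology F (smoothing D \<epsilon>')) K"
    unfolding openin_subtopology by blast
qed

text \<open>
  The circle through a given piece; the circles affected by a change of smoothing at
  crossing \<open>j\<close> are those through the pieces \<open>Smooth j s\<close>.
\<close>

definition circle_of :: "nat set \<Rightarrow> piece \<Rightarrow> 'a set" where
  "circle_of \<epsilon> P = (THE \<Gamma>. \<Gamma> \<in> circles F D \<epsilon> \<and> piece_path D \<epsilon> P ` {0..1} \<subseteq> \<Gamma>)"

lemma circle_of:
  assumes "P \<in> pieces D"
  shows "circle_of \<epsilon> P \<in> circles F D \<epsilon>" "piece_path D \<epsilon> P ` {0..1} \<subseteq> circle_of \<epsilon> P"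
  using theI'[OF ex1_circle_of_piece[OF assms, of \<epsilon>]] unfolding circle_of_def by (rule conjunct1, rule conjunct2)

lemma circle_of_eq:
  "\<lbrakk>P \<in> pieces D; \<Gamma> \<in> circles F D \<epsilon>; piece_path D \<epsilon> P ` {0..1} \<subseteq> \<Gamma>\<rbrakk> \<Longrightarrow> circle_of \<epsilon> P = \<Gamma>"
  using the1_equality[OF ex1_circle_of_piece[of P \<epsilon>]] unfolding circle_of_def by simp

lemma midpoint_not_in_smoothing:
  assumes j: "j < ncross D" and "(j \<in> \<epsilon>) \<noteq> (j \<in> \<epsilon>')"
  shows "piece_path D \<epsilon> (Smooth j s) (1/2) \<notin> smoothing D \<epsilon>'"
proof
  let ?m = "smoothing_arc (j \<in> \<epsilon>) s (1/2)"
  have m: "?m \<in> cball 0 1" by (rule subsetD[OF smoothing_arc_in_cball[of "j \<in> \<epsilon>" s]]) simp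
  assume "piece_path D \<epsilon> (Smooth j s) (1/2) \<in> smoothing D \<epsilon>'"
  then have "disc D j ?m \<in> smoothing D \<epsilon>'" by simp
  then obtain s' where "disc D j ?m \<in> piece_path D \<epsilon>' (Smooth j s') ` {0..1}"
    using smoothing_Int_disc[OF j] m by blast
  then obtain u where u: "u \<in> {0..1}" "disc D j ?m = disc D j (smoothing_arc (j \<in> \<epsilon>') s' u)"
    by auto
  have "smoothing_arc (j \<in> \<epsilon>') s' u \<in> cball 0 1"
    using smoothing_arc_in_cball[of "j \<in> \<epsilon>'" s'] u(1) by blast
  then have "?m = smoothing_arc (j \<in> \<epsilon>') s' u"
    by (rule inj_onD[OF disc_inj[OF j] u(2) m])
  moreover have "(j \<in> \<epsilon>') = (\<not> (j \<in> \<epsilon>))" using assms(2) by blast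
  ultimately have "?m = smoothing_arc (\<not> (j \<in> \<epsilon>)) s' u" by (simp only:)
  then show False using smoothing_arc_midpoint u(1) by blast
qed

lemma smooth_piece_not_in_common_circle:
  assumes "j < ncross D" "(j \<in> \<epsilon>) \<noteq> (j \<in> \<epsilon>')" "\<Gamma> \<in> circles F D \<epsilon>'"
  shows "\<not> piece_path D \<epsilon> (Smooth j s) ` {0..1} \<subseteq> \<Gamma>"
proof
  assume "piece_path D \<epsilon> (Smooth j s) ` {0..1} \<subseteq> \<Gamma>"
  then have "piece_path D \<epsilon> (Smooth j s) (1/2) \<in> \<Gamma>" by (rule subsetD) simp
  moreover have "\<Gamma> \<subseteq> smoothing D \<epsilon>'" using assms(3) Union_circles by blast
  ultimately show False using midpoint_not_in_smoothing[OF assms(1,2)] by blast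
qed

lemma Smooth_in_pieces [simp]: "Smooth j s \<in> pieces D \<longleftrightarrow> j < ncross D"
  by (auto simp: pieces_def)

text \<open>
  A circle that does not survive the change meets the crossing disc, so it passes through
  one of the arcs. Conversely, a circle through an arc contains its midpoint, which lies
  outside the other smoothing.
\<close>

lemma circles_Diff:
  assumes j: "j < ncross D" and \<epsilon>: "\<epsilon> - {j} = \<epsilon>' - {j}" and ne: "(j \<in> \<epsilon>) \<noteq> (j \<in> \<epsilon>')"
  shows "circles F D \<epsilon> - circles F D \<epsilon>' =
    {circle_of \<epsilon> (Smooth j True), circle_of \<epsilon> (Smooth j False)}"
proof (intro equalityI subsetI)
  fix \<Gamma> assume \<Gamma>: "\<Gamma> \<in> circles F D \<epsilon> - circles F D \<epsilon>'"
  then obtain p where p: "p \<in> \<Gamma>" "p \<in> disc D j ` cball 0 1"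
    using circle_away_from_disc[OF j \<epsilon>] by blast
  moreover have "\<Gamma> \<subseteq> smoothing D \<epsilon>" using \<Gamma> Union_circles by blast
  ultimately obtain s where s: "p \<in> piece_path D \<epsilon> (Smooth j s) ` {0..1}"
    using smoothing_Int_disc[OF j, of p \<epsilon>] by blast
  have "Smooth j s \<in> pieces D" using j by simp
  note c = circle_of[OF this, of \<epsilon>]
  have "\<Gamma> = circle_of \<epsilon> (Smooth j s)"
    by (rule circles_disjoint[OF _ c(1) p(1)]) (use \<Gamma> c(2) s in auto)
  then show "\<Gamma> \<in> {circle_of \<epsilon> (Smooth j True), circle_of \<epsilon> (Smooth j False)}"
    by (cases s) auto
next
  fix \<Gamma> assume "\<Gamma> \<in> {circle_of \<epsilon> (Smooth j True), circle_of \<epsilon> (Smooth j False)}"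
  then obtain s where s: "\<Gamma> = circle_of \<epsilon> (Smooth j s)" by blast
  have "Smooth j s \<in> pieces D" using j by simp
  note c = circle_of[OF this, of \<epsilon>]
  show "\<Gamma> \<in> circles F D \<epsilon> - circles F D \<epsilon>'"
    using c smooth_piece_not_in_common_circle[OF j ne, of \<Gamma> s] unfolding s by blast
qed

section \<open>The effect of changing one smoothing\<close>

text \<open>
  A handshake argument. Let \<open>C\<close> be a set of points which contains both or none of the ends
  of every edge, and of every smoothing arc at a crossing other than \<open>j\<close>. Every port is the
  end of precisely one edge, so the edges show that \<open>C\<close> contains an even number of ports.
  The smoothing arcs show the same for the ports at each crossing \<open>i \<noteq> j\<close>. An even number is
  left for \<open>j\<close>.
\<close>

lemma even_ports:
  assumes j: "j < ncross D"
    and edges: "\<And>i s. i < ncross D \<Longrightarrow> edge D i s 0 \<in> C \<longleftrightarrow> edge D i s 1 \<in> C"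
    and arcs: "\<And>i s. \<lbrakk>i < ncross D; i \<noteq> j\<rbrakk> \<Longrightarrow>
      piece_path D \<epsilon> (Smooth i s) 0 \<in> C \<longleftrightarrow> piece_path D \<epsilon> (Smooth i s) 1 \<in> C"
  shows "even (of_bool (disc D j 1 \<in> C) + of_bool (disc D j (-1) \<in> C)
    + of_bool (disc D j \<i> \<in> C) + of_bool (disc D j (-\<i>) \<in> C) :: nat)"
proof -
  define N where "N i = (of_bool (disc D i 1 \<in> C) + of_bool (disc D i (-1) \<in> C)
    + of_bool (disc D i \<i> \<in> C) + of_bool (disc D i (-\<i>) \<in> C) :: nat)" for i
  define A where "A = {..<ncross D} \<times> (UNIV :: bool set)"
  \<comment> \<open>Both the outgoing and the incoming ports are indexed by \<open>A\<close>. The map \<open>\<tau>\<close> below takes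
    the start of an edge to its finish; it is a permutation because edges are disjoint.\<close>
  define Out where "Out = {(i, s). (i, s) \<in> A \<and> out_port D i s \<in> C}"
  define In where "In = {(i, s). (i, s) \<in> A \<and> in_port D i s \<in> C}"
  have fin: "finite A" by (simp add: A_def)
  have "\<forall>a\<in>A. \<exists>b\<in>A. edge D (fst a) (snd a) 1 = in_port D (fst b) (snd b)"
  proof
    fix a assume "a \<in> A"
    then have "fst a < ncross D" by (auto simp: A_def)
    then obtain k t where "k < ncross D" "edge D (fst a) (snd a) 1 = in_port D k t"
      using edge_finish[of "fst a" "snd a"] by blast
    then show "\<exists>b\<in>A. edge D (fst a) (snd a) 1 = in_port D (fst b) (snd b)"
      by (intro bexI[of _ "(k, t)"]) (simp_all add: A_def)
  qed
  from bchoice[OF this[unfolded Bex_def]] obtain \<tau> where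
    \<tau>: "\<And>a. a \<in> A \<Longrightarrow> \<tau> a \<in> A"
      "\<And>a. a \<in> A \<Longrightarrow> edge D (fst a) (snd a) 1 = in_port D (fst (\<tau> a)) (snd (\<tau> a))"
    by blast
  have inj: "inj_on \<tau> A"
  proof (rule inj_onI)
    fix a b assume ab: "a \<in> A" "b \<in> A" "\<tau> a = \<tau> b"
    have "edge D (fst a) (snd a) 1 = edge D (fst b) (snd b) 1"
      using \<tau>(2)[OF ab(1)] \<tau>(2)[OF ab(2)] ab(3) by simp
    moreover have "edge D i s 1 \<in> edge D i s ` {0..1}" for i s by (rule imageI) simp
    ultimately have "\<not> disjnt (edge D (fst a) (snd a) ` {0..1}) (edge D (fst b) (snd b) ` {0..1})"
      unfolding disjnt_iff by metis
    moreover have "fst a < ncross D" "fst b < ncross D" using ab(1,2) by (auto simp: A_def)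
    ultimately have "(fst a, snd a) = (fst b, snd b)"
      using edge_disjoint[of "fst a" "fst b" "snd a" "snd b"] by blast
    then show "a = b" by (simp only: prod.collapse)
  qed
  have surj: "\<tau> ` A = A"
    by (rule endo_inj_surj[OF fin _ inj]) (auto intro: \<tau>(1))
  have iff: "a \<in> Out \<longleftrightarrow> \<tau> a \<in> In" if "a \<in> A" for a
  proof -
    have "fst a < ncross D" using that by (auto simp: A_def)
    then have "out_port D (fst a) (snd a) \<in> C \<longleftrightarrow> in_port D (fst (\<tau> a)) (snd (\<tau> a)) \<in> C"
      using edges[of "fst a" "snd a"] edge_start[of "fst a" "snd a"] \<tau>(2)[OF that] by simp
    then show ?thesis using that \<tau>(1)[OF that] by (auto simp: Out_def In_def case_prod_unfold)
  qed
  have "In \<subseteq> A" "Out \<subseteq> A" by (auto simp: In_def Out_def)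
  have "In = \<tau> ` Out"
  proof (intro equalityI subsetI)
    fix b assume "b \<in> In"
    moreover from this obtain a where "a \<in> A" "b = \<tau> a" using surj \<open>In \<subseteq> A\<close> by blast
    ultimately show "b \<in> \<tau> ` Out" using iff[of a] by simp
  next
    fix b assume "b \<in> \<tau> ` Out"
    then obtain a where "a \<in> Out" "b = \<tau> a" by blast
    then show "b \<in> In" using iff[of a] \<open>Out \<subseteq> A\<close> by blast
  qed
  then have card: "card In = card Out"
    using card_image[OF inj_on_subset[OF inj \<open>Out \<subseteq> A\<close>]] by simp
  have N: "N i = (\<Sum>s\<in>UNIV. of_bool (out_port D i s \<in> C) + of_bool (in_port D i s \<in> C))" for i
    by (simp add: N_def UNIV_bool out_port_def in_port_def)
  have sum_card: "(\<Sum>i<ncross D. \<Sum>s\<in>UNIV. of_bool (Q i s)) = card {(i, s). (i, s) \<in> A \<and> Q i s}"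
    for Q
  proof -
    have "(\<Sum>i<ncross D. \<Sum>s\<in>UNIV. of_bool (Q i s)) = (\<Sum>(i,s)\<in>A. of_bool (Q i s))"
      unfolding A_def by (rule sum.cartesian_product)
    also have "\<dots> = card {x \<in> A. case_prod Q x}"
      using fin by (simp add: sum_of_bool_eq case_prod_unfold Int_def)
    also have "{x \<in> A. case_prod Q x} = {(i, s). (i, s) \<in> A \<and> Q i s}" by auto
    finally show ?thesis .
  qed
  have "(\<Sum>i<ncross D. N i) = card Out + card In"
    unfolding N sum.distrib sum_card by (simp add: Out_def In_def)
  then have "even (\<Sum>i<ncross D. N i)" using card by simp
  moreover have "(\<Sum>i<ncross D. N i) = N j + (\<Sum>i\<in>{..<ncross D} - {j}. N i)"
    using j by (simp add: sum.remove)
  moreover have "even (\<Sum>i\<in>{..<ncross D} - {j}. N i)"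
  proof (rule dvd_sum)
    fix i assume "i \<in> {..<ncross D} - {j}"
    then show "even (N i)"
      using arcs[of i True] arcs[of i False]
      by (cases "i \<in> \<epsilon>") (auto simp: N_def smoothing_arc_def linepath_def)
  qed
  ultimately have "even (N j)" by simp
  then show ?thesis unfolding N_def .
qed

text \<open>
  If the two arcs at crossing \<open>j\<close> belonged to different circles in both smoothings, then the
  component of the port \<open>1\<close> in the complement of the arcs would contain neither \<open>- 1\<close>, nor
  the end of the second arc on the imaginary axis in either smoothing. It would contain just
  one of the four ports, against the handshake argument.
\<close>

lemma circles_through_arcs_eq:
  assumes j: "j < ncross D" and \<epsilon>: "\<epsilon> - {j} = \<epsilon>' - {j}" and ne: "(j \<in> \<epsilon>) \<noteq> (j \<in> \<epsilon>')"
  shows "circle_of \<epsilon> (Smooth j True) = circle_of \<epsilon> (Smooth j False) \<or>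
    circle_of \<epsilon>' (Smooth j True) = circle_of \<epsilon>' (Smooth j False)"
proof -
  define Q where "Q = pieces D - range (Smooth j)"
  define X where "X = (\<Union>P\<in>Q. piece_path D \<epsilon> P ` {0..1})"
  have same: "piece_path D \<epsilon> P = piece_path D \<epsilon>' P" if "P \<in> Q" for P
    by (rule piece_path_cong[OF \<epsilon>]) (use that in \<open>auto simp: Q_def\<close>)
  have X': "X = (\<Union>P\<in>Q. piece_path D \<epsilon>' P ` {0..1})"
    unfolding X_def using same by simp
  have XS: "X \<subseteq> smoothing D \<epsilon>" unfolding X_def Q_def smoothing_def by blast
  have XS': "X \<subseteq> smoothing D \<epsilon>'" unfolding X' Q_def smoothing_def by blast
  let ?T = "subtopology F X"
  define C where "C = connected_component_of_set ?T (disc D j 1)"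
  have conn: "connectedin ?T (piece_path D \<epsilon> P ` {0..1})" if "P \<in> Q" for P
    using that connectedin_path_image[OF pathin_piece_path] unfolding connectedin_subtopology
    by (auto simp: X_def Q_def)
  have iff: "piece_path D \<epsilon> P 0 \<in> C \<longleftrightarrow> piece_path D \<epsilon> P 1 \<in> C" if "P \<in> Q" for P
  proof -
    have "connected_component_of ?T (piece_path D \<epsilon> P 0) (piece_path D \<epsilon> P 1)"
      unfolding connected_component_of_def using conn[OF that] by (auto intro!: exI[of _ "piece_path D \<epsilon> P ` {0..1}"])
    then show ?thesis
      unfolding C_def using connected_component_of_trans connected_component_of_sym
      by (metis mem_Collect_eq)
  qed
  have "even (of_bool (disc D j 1 \<in> C) + of_bool (disc D j (-1) \<in> C)
    + of_bool (disc D j \<i> \<in> C) + of_bool (disc D j (-\<i>) \<in> C) :: nat)"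
  proof (rule even_ports[OF j])
    show "edge D i s 0 \<in> C \<longleftrightarrow> edge D i s 1 \<in> C" if "i < ncross D" for i s
      using iff[of "Edge i s"] that by (auto simp: Q_def pieces_def)
    show "piece_path D \<epsilon> (Smooth i s) 0 \<in> C \<longleftrightarrow> piece_path D \<epsilon> (Smooth i s) 1 \<in> C"
      if "i < ncross D" "i \<noteq> j" for i s
      using iff[of "Smooth i s"] that by (auto simp: Q_def)
  qed
  moreover have 1: "disc D j 1 \<in> C"
  proof -
    have "Edge j True \<in> Q" using j by (auto simp: Q_def pieces_def)
    moreover have "disc D j 1 = piece_path D \<epsilon> (Edge j True) 0"
      using edge_start[OF j] by (simp add: out_port_def)
    ultimately have "disc D j 1 \<in> X" unfolding X_def by force
    then have "disc D j 1 \<in> topspace ?T" using XS smoothing_subset by auto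
    then show ?thesis unfolding C_def by (simp add: connected_component_of_refl)
  qed
  ultimately obtain z where z: "z \<in> {-1, \<i>, -\<i>}" "disc D j z \<in> C"
    by (cases "disc D j (-1) \<in> C"; cases "disc D j \<i> \<in> C"; cases "disc D j (-\<i>) \<in> C") auto
  have Cconn: "connectedin F C" "C \<subseteq> X"
    using connectedin_connected_component_of[of ?T "disc D j 1"]
    unfolding C_def[symmetric] connectedin_subtopology by auto
  have key: "circle_of \<delta> (Smooth j True) = circle_of \<delta> (Smooth j False)"
    if "X \<subseteq> smoothing D \<delta>" "z \<in> smoothing_arc (j \<in> \<delta>) False ` {0..1}" for \<delta>
  proof -
    have T: "Smooth j s \<in> pieces D" for s using j by simp
    have "connectedin (subtopology F (smoothing D \<delta>)) C"
      using Cconn that(1) unfolding connectedin_subtopology by blast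
    then have sub: "C \<subseteq> \<Gamma>" if "\<Gamma> \<in> circles F D \<delta>" "p \<in> \<Gamma>" "p \<in> C" for \<Gamma> p
      using connected_components_of_maximal that unfolding circles_def disjnt_iff by metis
    have "disc D j 1 = piece_path D \<delta> (Smooth j True) 0"
      by (simp add: smoothing_arc_def linepath_def)
    then have "disc D j 1 \<in> circle_of \<delta> (Smooth j True)"
      using circle_of(2)[OF T, of \<delta> True] by auto
    then have "C \<subseteq> circle_of \<delta> (Smooth j True)" using sub[OF circle_of(1)[OF T]] 1 by blast
    moreover have "disc D j z \<in> circle_of \<delta> (Smooth j False)"
      using circle_of(2)[OF T, of \<delta> False] that(2) by auto
    ultimately show ?thesis
      using circles_disjoint[OF circle_of(1)[OF T] circle_of(1)[OF T]] z(2) by blast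
  qed
  \<comment> \<open>Each port other than \<open>1\<close> lies on the second arc of one of the two smoothings.\<close>
  have "\<exists>b. z \<in> smoothing_arc b False ` {0..1}"
  proof -
    have "smoothing_arc b False 0 = -1" "smoothing_arc True False 1 = -\<i>"
      "smoothing_arc False False 1 = \<i>" for b
      by (simp_all add: smoothing_arc_def linepath_def)
    then have "z \<in> {smoothing_arc True False 0, smoothing_arc True False 1, smoothing_arc False False 1}"
      using z(1) by auto
    moreover have "(0::real) \<in> {0..1}" "(1::real) \<in> {0..1}" by auto
    ultimately show ?thesis by blast
  qed
  then show ?thesis using key[OF XS] key[OF XS'] ne by (metis (full_types))
qed

lemma merges_or_splits_or_changes:
  assumes j: "j < ncross D" and \<epsilon>: "\<epsilon> - {j} = \<epsilon>' - {j}" and ne: "(j \<in> \<epsilon>) \<noteq> (j \<in> \<epsilon>')"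
  shows "(\<exists>\<Gamma>1 \<Gamma>2 \<Gamma>. merges F D \<epsilon> \<epsilon>' \<Gamma>1 \<Gamma>2 \<Gamma>) \<or> (\<exists>\<Gamma> \<Gamma>1 \<Gamma>2. splits F D \<epsilon> \<epsilon>' \<Gamma> \<Gamma>1 \<Gamma>2) \<or>
    (\<exists>\<Gamma> \<Gamma>'. changes F D \<epsilon> \<epsilon>' \<Gamma> \<Gamma>')"
proof -
  have "circles F D \<epsilon> - circles F D \<epsilon>' = {circle_of \<epsilon> (Smooth j True), circle_of \<epsilon> (Smooth j False)}"
    "circles F D \<epsilon>' - circles F D \<epsilon> = {circle_of \<epsilon>' (Smooth j True), circle_of \<epsilon>' (Smooth j False)}"
    using circles_Diff[OF j] \<epsilon> ne by metis+
  then show ?thesis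
    using circles_through_arcs_eq[OF assms] unfolding merges_def splits_def changes_def
    by (metis insert_absorb2)
qed

end

section \<open>Homology classes of circles\<close>

lemma cycle_is_boundary_if_contractible:
  assumes "contractible_space X" "p \<noteq> 0" "singular_chain p X c" "chain_boundary p c = 0"
  obtains b where "singular_chain (Suc p) X b" "chain_boundary (Suc p) b = c"
proof -
  have "trivial_group (homology_group (int p) X)"
    using trivial_reduced_homology_group_contractible_space[OF assms(1), of "int p"] assms(2)
    by (simp add: un_reduced_homology_group)
  moreover have "homologous_rel_set p X {} c \<in> carrier (homology_group (int p) X)"
    using assms(3,4) by (auto simp: carrier_relative_homology_group singular_cycle)
  ultimately have "homologous_rel_set p X {} c = singular_relboundary_set p X {}"
    by (simp add: trivial_group_def)
  then show ?thesis
    using that by (auto simp: homologous_rel_set_eq_relboundary singular_boundary)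
qed

lemma singular_simplex_path_simplex:
  assumes "pathin X g" shows "singular_simplex 1 X (path_simplex g)"
proof -
  let ?S = "subtopology (powertop_real UNIV) (standard_simplex 1)"
  have "continuous_map ?S euclideanreal (\<lambda>t. t 1)"
    by (intro continuous_map_from_subtopology continuous_map_product_projection) simp
  then have "continuous_map ?S (top_of_set {0..1}) (\<lambda>t. t 1)"
    by (auto simp: continuous_map_in_subtopology standard_simplex_def)
  then have "continuous_map ?S X (g \<circ> (\<lambda>t. t 1))"
    using assms unfolding pathin_def by (rule continuous_map_compose)
  then have "continuous_map ?S X (path_simplex g)"
    by (rule continuous_map_eq) (auto simp: path_simplex_def)
  then show ?thesis by (simp add: singular_simplex_def path_simplex_def)
qed

lemma chain_boundary_path_simplex:
  "chain_boundary 1 (frag_of (path_simplex g)) =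
     frag_of (\<lambda>t\<in>standard_simplex 0. g 1) - frag_of (\<lambda>t\<in>standard_simplex 0. g 0)"
proof -
  have 0: "singular_face 1 0 (path_simplex g) = (\<lambda>t\<in>standard_simplex 0. g 1)"
    by (auto simp: singular_face_def path_simplex_def simplical_face_def fun_eq_iff
        standard_simplex_def restrict_def)
  have 1: "singular_face 1 1 (path_simplex g) = (\<lambda>t\<in>standard_simplex 0. g 0)"
    by (auto simp: singular_face_def path_simplex_def simplical_face_def fun_eq_iff
        standard_simplex_def restrict_def)
  show ?thesis using 0 1 by (simp add: chain_boundary_of)
qed

lemma simplex_map_path_simplex: "simplex_map 1 f (path_simplex g) = path_simplex (f \<circ> g)"
  by (auto simp: simplex_map_def path_simplex_def)

lemma mod2_boundariesI: 
  "\<lbrakk>singular_chain (Suc p) X b; singular_chain p X c\<rbrakk> \<Longrightarrow>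
     chain_boundary (Suc p) b + frag_cmul 2 c \<in> mod2_boundaries p X"
  unfolding mod2_boundaries_def by blast

lemma chain_boundary_in_mod2_boundaries:
  "singular_chain (Suc p) X b \<Longrightarrow> chain_boundary (Suc p) b \<in> mod2_boundaries p X"
  using mod2_boundariesI[of p X b 0] by (simp add: singular_chain_0)

lemma double_in_mod2_boundaries: "singular_chain p X c \<Longrightarrow> c + c \<in> mod2_boundaries p X"
proof -
  assume "singular_chain p X c"
  then have "frag_cmul (1 + 1) c \<in> mod2_boundaries p X"
    using mod2_boundariesI[of p X 0 c] by (simp add: singular_chain_0)
  then show ?thesis by (simp only: frag_cmul_distrib frag_cmul_one)
qed

lemma zero_in_mod2_boundaries: "0 \<in> mod2_boundaries p X"
  using double_in_mod2_boundaries[of p X 0] by (simp add: singular_chain_0)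

lemma mod2_boundaries_add:
  "\<lbrakk>x \<in> mod2_boundaries p X; y \<in> mod2_boundaries p X\<rbrakk> \<Longrightarrow> x + y \<in> mod2_boundaries p X"
proof -
  assume "x \<in> mod2_boundaries p X" "y \<in> mod2_boundaries p X"
  then obtain b c b' c' where
    "x = chain_boundary (Suc p) b + frag_cmul 2 c" "y = chain_boundary (Suc p) b' + frag_cmul 2 c'"
    "singular_chain (Suc p) X b" "singular_chain p X c"
    "singular_chain (Suc p) X b'" "singular_chain p X c'"
    unfolding mod2_boundaries_def by blast
  then show ?thesis
    using mod2_boundariesI[of p X "b + b'" "c + c'"]
    by (simp add: singular_chain_add chain_boundary_add frag_cmul_distrib2 algebra_simps)
qed

lemma mod2_boundaries_minus: "x \<in> mod2_boundaries p X \<Longrightarrow> - x \<in> mod2_boundaries p X"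
proof -
  assume "x \<in> mod2_boundaries p X"
  then obtain b c where
    "x = chain_boundary (Suc p) b + frag_cmul 2 c"
    "singular_chain (Suc p) X b" "singular_chain p X c"
    unfolding mod2_boundaries_def by blast
  moreover have "frag_cmul 2 (- c) = - frag_cmul 2 c"
    by (rule eq_neg_iff_add_eq_0[THEN iffD2]) (simp flip: frag_cmul_distrib2)
  ultimately have "- x = chain_boundary (Suc p) (- b) + frag_cmul 2 (- c)"
    by (simp only: chain_boundary_minus minus_add_distrib)
  then show ?thesis
    using mod2_boundariesI[of p X "- b" "- c"] \<open>singular_chain (Suc p) X b\<close> \<open>singular_chain p X c\<close>
    by (simp only: singular_chain_minus)
qed

lemma mod2_boundaries_diff:
  "\<lbrakk>x \<in> mod2_boundaries p X; y \<in> mod2_boundaries p X\<rbrakk> \<Longrightarrow> x - y \<in> mod2_boundaries p X"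
  using mod2_boundaries_add[of x p X "- y"] mod2_boundaries_minus[of y p X] by simp

text \<open>
  Addition in the group of cycles is addition of chains, so equality of classes becomes a
  question about which chains are boundaries.
\<close>

lemma mod2_homology_class_eq_image:
  "mod2_homology_class p X c = (\<lambda>h. h + c) ` mod2_boundaries p X"
  by (auto simp: mod2_homology_class_def r_coset_def)

lemma mod2_homology_class_eq_iff:
  "mod2_homology_class p X c = mod2_homology_class p X c' \<longleftrightarrow> c - c' \<in> mod2_boundaries p X"
proof
  assume eq: "mod2_homology_class p X c = mod2_homology_class p X c'"
  have "c \<in> mod2_homology_class p X c"
    unfolding mod2_homology_class_eq_image
    by (rule image_eqI[of _ _ 0]) (simp_all add: zero_in_mod2_boundaries)
  then have "c \<in> mod2_homology_class p X c'" by (simp only: eq)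
  then obtain h where "h \<in> mod2_boundaries p X" "c = h + c'"
    unfolding mod2_homology_class_eq_image image_iff by blast
  then show "c - c' \<in> mod2_boundaries p X" by simp
next
  have sub: "mod2_homology_class p X c \<subseteq> mod2_homology_class p X c'"
    if "c - c' \<in> mod2_boundaries p X" for c c'
    unfolding mod2_homology_class_eq_image
  proof (intro image_subsetI)
    fix h assume "h \<in> mod2_boundaries p X"
    then have "h + (c - c') \<in> mod2_boundaries p X" using that by (rule mod2_boundaries_add)
    then show "h + c \<in> (\<lambda>h. h + c') ` mod2_boundaries p X"
      by (rule rev_image_eqI) (simp add: algebra_simps)
  qed
  assume "c - c' \<in> mod2_boundaries p X"
  then show "mod2_homology_class p X c = mod2_homology_class p X c'"
    using sub[of c c'] sub[of c' c] mod2_boundaries_minus[of "c - c'" p X] by auto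
qed

lemma one_mod2_homology_group: "\<one>\<^bsub>mod2_homology_group p X\<^esub> = mod2_boundaries p X"
  by (simp add: mod2_homology_group_def FactGroup_def)

lemma mod2_homology_class_eq_one_iff:
  "mod2_homology_class p X c = \<one>\<^bsub>mod2_homology_group p X\<^esub> \<longleftrightarrow> c \<in> mod2_boundaries p X"
  using mod2_homology_class_eq_iff[of p X c 0]
  by (simp add: one_mod2_homology_group mod2_homology_class_eq_image[of p X 0])

text \<open>
  The four arcs are the sides of a square. With their orientations, the difference of the
  two smoothings is an integral cycle, and the disc is contractible.
\<close>

lemma smoothing_arcs_boundary:
  "\<exists>b. singular_chain 2 (top_of_set (cball 0 1)) b \<and>
     chain_boundary 2 b = (\<Sum>s\<in>UNIV. frag_of (path_simplex (smoothing_arc False s)))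
       - (\<Sum>s\<in>UNIV. frag_of (path_simplex (smoothing_arc True s)))"
  (is "\<exists>b. _ \<and> _ = ?c")
proof -
  let ?X = "top_of_set (cball (0::complex) 1)"
  have "contractible_space ?X"
    by (simp add: contractible_space_top_of_set convex_imp_contractible)
  moreover have "singular_chain 1 ?X ?c"
    by (intro singular_chain_diff singular_chain_sum)
      (simp_all add: singular_chain_of singular_simplex_path_simplex[OF pathin_smoothing_arc, simplified])
  moreover have "chain_boundary 1 ?c = 0"
    unfolding UNIV_bool
    by (simp add: chain_boundary_diff chain_boundary_add chain_boundary_path_simplex[simplified]
        smoothing_arc_def linepath_def)
  ultimately obtain b where "singular_chain (Suc 1) ?X b" "chain_boundary (Suc 1) b = ?c"
    using cycle_is_boundary_if_contractible[of ?X 1 ?c] by blast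
  then show ?thesis unfolding Suc_1 by blast
qed

context link_diagram
begin

definition piece_chain :: "nat set \<Rightarrow> piece \<Rightarrow> 'a chain" where
  "piece_chain \<epsilon> P = frag_of (path_simplex (piece_path D \<epsilon> P))"

definition circle_chain :: "nat set \<Rightarrow> 'a set \<Rightarrow> 'a chain" where
  "circle_chain \<epsilon> \<Gamma> = sum (piece_chain \<epsilon>) {P \<in> pieces D. piece_path D \<epsilon> P ` {0..1} \<subseteq> \<Gamma>}"

lemma circle_class_eq: "circle_class F D \<epsilon> \<Gamma> = mod2_homology_class 1 F (circle_chain \<epsilon> \<Gamma>)"
  by (simp add: circle_class_def circle_chain_def piece_chain_def)

lemma singular_chain_circle_chain: "singular_chain 1 F (circle_chain \<epsilon> \<Gamma>)"
  unfolding circle_chain_def piece_chain_def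
  by (rule singular_chain_sum)
    (simp add: singular_chain_of singular_simplex_path_simplex[simplified] pathin_piece_path)

text \<open>Every piece lies in exactly one circle.\<close>

lemma sum_circle_chain: "sum (circle_chain \<epsilon>) (circles F D \<epsilon>) = sum (piece_chain \<epsilon>) (pieces D)"
proof -
  have "circle_chain \<epsilon> \<Gamma> = sum (piece_chain \<epsilon>) {P \<in> pieces D. circle_of \<epsilon> P = \<Gamma>}"
    if "\<Gamma> \<in> circles F D \<epsilon>" for \<Gamma>
  proof -
    have "{P \<in> pieces D. piece_path D \<epsilon> P ` {0..1} \<subseteq> \<Gamma>} = {P \<in> pieces D. circle_of \<epsilon> P = \<Gamma>}"
      by (intro Collect_cong) (metis circle_of(2) circle_of_eq[OF _ that])
    then show ?thesis unfolding circle_chain_def by simp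
  qed
  then have "sum (circle_chain \<epsilon>) (circles F D \<epsilon>)
      = (\<Sum>\<Gamma>\<in>circles F D \<epsilon>. sum (piece_chain \<epsilon>) {P \<in> pieces D. circle_of \<epsilon> P = \<Gamma>})"
    by simp
  also have "\<dots> = sum (piece_chain \<epsilon>) (pieces D)"
    by (rule sum.group) (simp_all add: image_subset_iff circle_of(1))
  finally show ?thesis .
qed

lemma smooth_pieces_boundary:
  assumes j: "j < ncross D" and ne: "(j \<in> \<epsilon>) \<noteq> (j \<in> \<epsilon>')"
  shows "(\<Sum>s\<in>UNIV. piece_chain \<epsilon> (Smooth j s)) - (\<Sum>s\<in>UNIV. piece_chain \<epsilon>' (Smooth j s))
    \<in> mod2_boundaries 1 F"
proof -
  define T where "T b = (\<Sum>s\<in>UNIV. frag_of (path_simplex (disc D j \<circ> smoothing_arc b s)))" for b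
  obtain b where b: "singular_chain 2 (top_of_set (cball 0 1)) b"
    "chain_boundary 2 b = (\<Sum>s\<in>UNIV. frag_of (path_simplex (smoothing_arc False s)))
       - (\<Sum>s\<in>UNIV. frag_of (path_simplex (smoothing_arc True s)))"
    using smoothing_arcs_boundary by blast
  have "chain_boundary 2 (chain_map 2 (disc D j) b) = chain_map 1 (disc D j) (chain_boundary 2 b)"
    using chain_boundary_chain_map[OF b(1)] by simp
  also have "\<dots> = T False - T True"
    unfolding b(2) T_def UNIV_bool
    by (simp add: chain_map_diff chain_map_add simplex_map_path_simplex[simplified])
  finally have "T False - T True \<in> mod2_boundaries 1 F"
    using chain_boundary_in_mod2_boundaries[of 1 F "chain_map 2 (disc D j) b"]
      singular_chain_chain_map[OF b(1) disc_continuous[OF j]] by (simp add: numeral_2_eq_2)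
  from this mod2_boundaries_minus[OF this]
  have "T b - T (\<not> b) \<in> mod2_boundaries 1 F" for b
    by (cases b) (simp_all only: minus_diff_eq not_True_eq_False not_False_eq_True)
  moreover have "(\<Sum>s\<in>UNIV. piece_chain \<delta> (Smooth j s)) = T (j \<in> \<delta>)" for \<delta>
    by (simp add: T_def piece_chain_def)
  moreover have "(j \<in> \<epsilon>') = (\<not> (j \<in> \<epsilon>))" using ne by blast
  ultimately show ?thesis by (simp only:)
qed

lemma circle_chain_cong:
  assumes j: "j < ncross D" and \<epsilon>: "\<epsilon> - {j} = \<epsilon>' - {j}" and ne: "(j \<in> \<epsilon>) \<noteq> (j \<in> \<epsilon>')"
    and \<Gamma>: "\<Gamma> \<in> circles F D \<epsilon>" "\<Gamma> \<in> circles F D \<epsilon>'"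
  shows "circle_chain \<epsilon> \<Gamma> = circle_chain \<epsilon>' \<Gamma>"
proof -
  let ?in = "\<lambda>\<delta> P. piece_path D \<delta> P ` {0..1} \<subseteq> \<Gamma>"
  have "?in \<epsilon> P = ?in \<epsilon>' P \<and> (?in \<epsilon>' P \<longrightarrow> piece_path D \<epsilon> P = piece_path D \<epsilon>' P)" for P
  proof (cases "\<exists>s. P = Smooth j s")
    case True
    then obtain s where "P = Smooth j s" by blast
    then show ?thesis
      using smooth_piece_not_in_common_circle[OF j ne \<Gamma>(2), of s]
        smooth_piece_not_in_common_circle[OF j ne[symmetric] \<Gamma>(1), of s] by metis
  next
    case False
    then have "piece_path D \<epsilon> P = piece_path D \<epsilon>' P" using piece_path_cong[OF \<epsilon>, of P] by metis
    then show ?thesis by simp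
  qed
  note same = this
  have "{P \<in> pieces D. ?in \<epsilon> P} = {P \<in> pieces D. ?in \<epsilon>' P}"
    by (intro Collect_cong conj_cong refl) (rule conjunct1[OF same])
  moreover have "piece_chain \<epsilon> P = piece_chain \<epsilon>' P" if "P \<in> {P \<in> pieces D. ?in \<epsilon>' P}" for P
    using that conjunct2[OF same, of P] unfolding piece_chain_def mem_Collect_eq by metis
  ultimately show ?thesis
    unfolding circle_chain_def by (rule sum.cong)
qed

text \<open>
  The circles common to both smoothings are represented by the same chains, so they cancel
  from the difference of the total chains; what remains there comes from the arcs in the
  crossing disc.
\<close>

lemma smoothing_change_homologous:
  assumes j: "j < ncross D" and \<epsilon>: "\<epsilon> - {j} = \<epsilon>' - {j}" and ne: "(j \<in> \<epsilon>) \<noteq> (j \<in> \<epsilon>')"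
  shows "sum (circle_chain \<epsilon>) (circles F D \<epsilon> - circles F D \<epsilon>')
    - sum (circle_chain \<epsilon>') (circles F D \<epsilon>' - circles F D \<epsilon>) \<in> mod2_boundaries 1 F"
proof -
  let ?A = "circles F D \<epsilon>" and ?B = "circles F D \<epsilon>'"
  let ?S = "range (Smooth j)"
  have common: "sum (circle_chain \<epsilon>) (?A \<inter> ?B) = sum (circle_chain \<epsilon>') (?A \<inter> ?B)"
    by (rule sum.cong) (use circle_chain_cong[OF assms] in auto)
  have pc: "sum (piece_chain \<delta>) (pieces D) = (\<Sum>s\<in>UNIV. piece_chain \<delta> (Smooth j s))
      + sum (piece_chain \<delta>) (pieces D - ?S)" for \<delta>
  proof -
    have "?S \<subseteq> pieces D" using j by auto
    then have "sum (piece_chain \<delta>) (pieces D) = sum (piece_chain \<delta>) (pieces D - ?S) + sum (piece_chain \<delta>) ?S"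
      by (rule sum.subset_diff) simp
    also have "sum (piece_chain \<delta>) ?S = (\<Sum>s\<in>UNIV. piece_chain \<delta> (Smooth j s))"
      by (subst sum.reindex) (auto simp: inj_on_def)
    finally show ?thesis by (simp add: add.commute)
  qed
  have other: "sum (piece_chain \<epsilon>) (pieces D - ?S) = sum (piece_chain \<epsilon>') (pieces D - ?S)"
  proof (rule sum.cong[OF refl])
    fix P assume "P \<in> pieces D - ?S"
    then have "\<forall>s. P \<noteq> Smooth j s" by blast
    then have "piece_path D \<epsilon> P = piece_path D \<epsilon>' P" by (rule piece_path_cong[OF \<epsilon>])
    then show "piece_chain \<epsilon> P = piece_chain \<epsilon>' P" by (simp only: piece_chain_def)
  qed
  have "sum (circle_chain \<epsilon>) (?A - ?B) - sum (circle_chain \<epsilon>') (?B - ?A)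
      = sum (circle_chain \<epsilon>) ?A - sum (circle_chain \<epsilon>') ?B"
    using common sum.Int_Diff[of ?A "circle_chain \<epsilon>" ?B] sum.Int_Diff[of ?B "circle_chain \<epsilon>'" ?A]
    by (simp add: Int_commute)
  also have "\<dots> = (\<Sum>s\<in>UNIV. piece_chain \<epsilon> (Smooth j s)) - (\<Sum>s\<in>UNIV. piece_chain \<epsilon>' (Smooth j s))"
    unfolding sum_circle_chain using pc[of \<epsilon>] pc[of \<epsilon>'] other by simp
  finally show ?thesis using smooth_pieces_boundary[OF j ne] by simp
qed

lemma splits_homologous:
  assumes j: "j < ncross D" and \<epsilon>: "\<epsilon> - {j} = \<epsilon>' - {j}" and ne: "(j \<in> \<epsilon>) \<noteq> (j \<in> \<epsilon>')"
    and "splits F D \<epsilon> \<epsilon>' \<Gamma> \<Gamma>1 \<Gamma>2"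
  shows "circle_chain \<epsilon> \<Gamma> - (circle_chain \<epsilon>' \<Gamma>1 + circle_chain \<epsilon>' \<Gamma>2) \<in> mod2_boundaries 1 F"
  using smoothing_change_homologous[OF assms(1-3)] assms(4) unfolding splits_def by auto

text \<open>The sum of the new classes is zero, and classes modulo 2 are their own inverses.\<close>

lemma splits_null_circle:
  assumes "j < ncross D" "\<epsilon> - {j} = \<epsilon>' - {j}" "(j \<in> \<epsilon>) \<noteq> (j \<in> \<epsilon>')" "splits F D \<epsilon> \<epsilon>' \<Gamma> \<Gamma>1 \<Gamma>2"
    and "circle_class F D \<epsilon> \<Gamma> = \<one>\<^bsub>mod2_homology_group 1 F\<^esub>"
  shows "circle_class F D \<epsilon>' \<Gamma>1 = circle_class F D \<epsilon>' \<Gamma>2"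
proof -
  let ?c = "circle_chain \<epsilon> \<Gamma>" and ?c1 = "circle_chain \<epsilon>' \<Gamma>1" and ?c2 = "circle_chain \<epsilon>' \<Gamma>2"
  have "?c \<in> mod2_boundaries 1 F"
    using assms(5) by (simp only: circle_class_eq mod2_homology_class_eq_one_iff)
  from mod2_boundaries_diff[OF this splits_homologous[OF assms(1-4)]]
  have "?c1 + ?c2 \<in> mod2_boundaries 1 F" by (simp add: add.commute)
  from mod2_boundaries_diff[OF this double_in_mod2_boundaries[OF singular_chain_circle_chain[of \<epsilon>' \<Gamma>2]]]
  have "?c1 - ?c2 \<in> mod2_boundaries 1 F" by (simp add: algebra_simps)
  then show ?thesis by (simp only: circle_class_eq mod2_homology_class_eq_iff)
qed

lemma splits_off_null_circle:
  assumes "j < ncross D" "\<epsilon> - {j} = \<epsilon>' - {j}" "(j \<in> \<epsilon>) \<noteq> (j \<in> \<epsilon>')" "splits F D \<epsilon> \<epsilon>' \<Gamma> \<Gamma>1 \<Gamma>2"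
    and "circle_class F D \<epsilon>' \<Gamma>1 = \<one>\<^bsub>mod2_homology_group 1 F\<^esub>"
  shows "circle_class F D \<epsilon>' \<Gamma>2 = circle_class F D \<epsilon> \<Gamma>"
proof -
  let ?c = "circle_chain \<epsilon> \<Gamma>" and ?c1 = "circle_chain \<epsilon>' \<Gamma>1" and ?c2 = "circle_chain \<epsilon>' \<Gamma>2"
  have "?c1 \<in> mod2_boundaries 1 F"
    using assms(5) by (simp only: circle_class_eq mod2_homology_class_eq_one_iff)
  from mod2_boundaries_add[OF splits_homologous[OF assms(1-4)] this]
  have "?c - ?c2 \<in> mod2_boundaries 1 F" by (simp add: algebra_simps)
  then have "circle_class F D \<epsilon> \<Gamma> = circle_class F D \<epsilon>' \<Gamma>2"
    by (simp only: circle_class_eq mod2_homology_class_eq_iff)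
  then show ?thesis by (rule sym)
qed

end

section \<open>The lowest cohomology group as a space of cocycles\<close>

lemma of_bool_bit_eq_1 [simp]: "of_bool (b = 1) = (b :: bit)"
  by (cases b) simp_all

lemma group_cochain_group: "group (cochain_group L F D i)"
  by (rule groupI) (auto simp: cochain_group_def fun_eq_iff intro!: bexI[of _ "x" for x])

text \<open>There are no smoothings with a negative number of 1-smoothed crossings.\<close>

lemma coboundaries_lowest: "coboundaries L F D (- int (nneg D)) = {\<lambda>e. 0}"
proof -
  have "cochain_basis L F D (- int (nneg D) - 1) = {}"
    by (auto simp: cochain_basis_def)
  then have "carrier (cochain_group L F D (- int (nneg D) - 1)) = {\<lambda>e. 0}"
    "differential L F D (- int (nneg D) - 1) v = (\<lambda>e. 0)" for v
    by (auto simp: cochain_group_def differential_def fun_eq_iff)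
  then show ?thesis by (simp add: coboundaries_def)
qed

text \<open>
  The group of coboundaries is trivial, so the cohomology group consists of the singletons
  of the elements of the group generated by the cocycles.
\<close>

lemma lowest_cohomology_nontrivial_iff:
  "carrier (link_cohomology L F D (- int (nneg D))) \<noteq> {\<one>\<^bsub>link_cohomology L F D (- int (nneg D))\<^esub>}
   \<longleftrightarrow> (\<exists>v \<in> cocycles L F D (- int (nneg D)). v \<noteq> (\<lambda>e. 0))"
proof -
  let ?i = "- int (nneg D)"
  let ?G = "cochain_group L F D ?i" and ?Z = "cocycles L F D ?i"
  interpret G: group ?G by (rule group_cochain_group)
  have one: "\<one>\<^bsub>?G\<^esub> = (\<lambda>e. 0)" by (simp add: cochain_group_def)
  have sub: "?Z \<subseteq> carrier ?G" by (auto simp: cocycles_def)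
  have coset: "{\<lambda>e. 0} #>\<^bsub>subgroup_generated ?G ?Z\<^esub> v = {v}" for v
    by (simp add: r_coset_def cochain_group_def)
  have carrier: "carrier (link_cohomology L F D ?i) = (\<lambda>v. {v}) ` generate ?G ?Z"
    using sub by (auto simp: link_cohomology_def FactGroup_def RCOSETS_def coboundaries_lowest coset
        carrier_subgroup_generated Int_absorb1)
  have "\<one>\<^bsub>link_cohomology L F D ?i\<^esub> = {\<lambda>e. 0}"
    by (simp add: link_cohomology_def FactGroup_def coboundaries_lowest)
  moreover have "(\<lambda>v. {v}) ` generate ?G ?Z \<noteq> {{\<lambda>e. 0}} \<longleftrightarrow> (\<exists>v\<in>?Z. v \<noteq> (\<lambda>e. 0))"
  proof
    assume "(\<lambda>v. {v}) ` generate ?G ?Z \<noteq> {{\<lambda>e. 0}}"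
    then have "generate ?G ?Z \<noteq> {\<one>\<^bsub>?G\<^esub>}" unfolding one by auto
    then have "\<not> generate ?G ?Z \<subseteq> {\<one>\<^bsub>?G\<^esub>}" using generate.one[of ?G ?Z] by blast
    then have "\<not> ?Z \<subseteq> {\<one>\<^bsub>?G\<^esub>}"
      using G.generate_subgroup_incl[OF _ G.triv_subgroup] by blast
    then show "\<exists>v\<in>?Z. v \<noteq> (\<lambda>e. 0)" unfolding one by blast
  next
    assume "\<exists>v\<in>?Z. v \<noteq> (\<lambda>e. 0)"
    then obtain v where "v \<in> ?Z" "v \<noteq> (\<lambda>e. 0)" by blast
    then have "{v} \<in> (\<lambda>v. {v}) ` generate ?G ?Z" "{v} \<noteq> {\<lambda>e. 0}"
      using generate.incl[of v ?Z ?G] by auto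
    then show "(\<lambda>v. {v}) ` generate ?G ?Z \<noteq> {{\<lambda>e. 0}}" by blast
  qed
  ultimately show ?thesis using carrier by simp
qed

lemma cochain_basis_lowest: "cochain_basis L F D (- int (nneg D)) = Pair {} ` state_basis L F D {}"
  by (auto simp: cochain_basis_def card_eq_0_iff dest: finite_subset)

lemma cochain_basis_next:
  "cochain_basis L F D (- int (nneg D) + 1) = (SIGMA \<epsilon> : (\<lambda>j. {j}) ` {..<ncross D}. state_basis L F D \<epsilon>)"
  by (auto simp: cochain_basis_def card_1_singleton_iff)

lemma cocycles_lowest_iff:
  "v \<in> cocycles L F D (- int (nneg D)) \<longleftrightarrow>
    (\<forall>e. e \<notin> Pair {} ` state_basis L F D {} \<longrightarrow> v e = 0) \<and>
    (\<forall>j<ncross D. \<forall>b' \<in> state_basis L F D {j}.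
       (\<Sum>b \<in> state_basis L F D {}. v ({}, b) * edge_entry L F D {} {j} b b') = 0)"
proof -
  let ?i = "- int (nneg D)"
  have "(\<Sum>(\<epsilon>, b) \<in> cochain_basis L F D ?i. v (\<epsilon>, b) * edge_entry L F D \<epsilon> \<epsilon>' b b')
    = (\<Sum>b \<in> state_basis L F D {}. v ({}, b) * edge_entry L F D {} \<epsilon>' b b')" for \<epsilon>' b'
    unfolding cochain_basis_lowest by (subst sum.reindex) (auto simp: inj_on_def)
  then have "differential L F D ?i v (\<epsilon>', b') =
      (if (\<epsilon>', b') \<in> (SIGMA \<epsilon> : (\<lambda>j. {j}) ` {..<ncross D}. state_basis L F D \<epsilon>)
       then \<Sum>b \<in> state_basis L F D {}. v ({}, b) * edge_entry L F D {} \<epsilon>' b b' else 0)" for \<epsilon>' b'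
    unfolding differential_def prod.case cochain_basis_next by (simp only:)
  then have "differential L F D ?i v = (\<lambda>e. 0) \<longleftrightarrow> (\<forall>j<ncross D. \<forall>b' \<in> state_basis L F D {j}.
       (\<Sum>b \<in> state_basis L F D {}. v ({}, b) * edge_entry L F D {} {j} b b') = 0)"
    by (auto simp: fun_eq_iff)
  then show ?thesis
    by (simp add: cocycles_def cochain_group_def cochain_basis_lowest)
qed

section \<open>The algebra\<close>

lemma xbasis_L_algebra [simp]: "xbasis (L_algebra \<pi>) = L_basis \<pi>"
  and xmult_L_algebra [simp]: "xmult (L_algebra \<pi>) = L_mult \<pi>"
  and xcomult_L_algebra [simp]: "xcomult (L_algebra \<pi>) = L_comult \<pi>"
  and xtheta_L_algebra [simp]: "xtheta (L_algebra \<pi>) = (\<lambda>\<alpha>. basis_sum {})"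
  by (simp_all add: L_algebra_def)

lemma basis_sum_eq_1_iff [simp]: "basis_sum S b = 1 \<longleftrightarrow> b \<in> S"
  by (simp add: basis_sum_def)

lemma basis_sum_empty [simp]: "basis_sum {} b = 0"
  by (simp add: basis_sum_def)

lemma L_comult_commute: "L_comult \<pi> \<beta> \<alpha> c (d', d) = L_comult \<pi> \<alpha> \<beta> c (d, d')"
  by (auto simp: L_comult_def basis_sum_def)

text \<open>
  The coefficient of \<open>x\<close> is a counit: this is why the comultiplication is injective when one
  of the two new circles is null-homologous.
\<close>

lemma L_comult_counit:
  "\<lbrakk>c \<in> L_basis \<pi> \<beta>; d \<in> L_basis \<pi> \<beta>\<rbrakk> \<Longrightarrow> L_comult \<pi> \<one>\<^bsub>\<pi>\<^esub> \<beta> c (L_x, d) = of_bool (c = d)"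
  by (auto simp: L_comult_def basis_sum_def L_basis_def split: if_splits)

text \<open>
  The exchange of \<open>y\<^sub>\<alpha>\<close> and \<open>z\<^sub>\<alpha>\<close>. Away from the unit it is respected by the multiplication,
  and by the comultiplications of nonzero degrees; it makes the image of \<open>y\<^sub>\<alpha> + z\<^sub>\<alpha>\<close> cancel.
\<close>

fun L_swap :: "'g L_gen \<Rightarrow> 'g L_gen" where
  "L_swap (L_y \<alpha>) = L_z \<alpha>"
| "L_swap (L_z \<alpha>) = L_y \<alpha>"
| "L_swap b = b"

lemma L_swap_swap [simp]: "L_swap (L_swap b) = b"
  by (cases b) auto

lemma L_swap_eq_one_iff [simp]: "L_swap b = L_one \<longleftrightarrow> b = L_one"
  by (cases b) auto

lemma L_swap_in_basis [simp]: "L_swap b \<in> L_basis \<pi> \<alpha> \<longleftrightarrow> b \<in> L_basis \<pi> \<alpha>"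
  by (cases b) (auto simp: L_basis_def)

lemma L_mult_swap:
  "\<lbrakk>a \<noteq> L_one; b \<noteq> L_one\<rbrakk> \<Longrightarrow> L_mult \<pi> (L_swap a) (L_swap b) = L_mult \<pi> a b"
  by (cases a; cases b) auto

lemma L_comult_swap:
  "\<lbrakk>\<alpha> \<noteq> \<one>\<^bsub>\<pi>\<^esub>; \<beta> \<noteq> \<one>\<^bsub>\<pi>\<^esub>\<rbrakk> \<Longrightarrow> L_comult \<pi> \<alpha> \<beta> (L_swap b) = L_comult \<pi> \<alpha> \<beta> b"
  by (auto simp: L_comult_def)

text \<open>
  The involution exchanges the two halves of \<open>S\<close> on which \<open>p\<close> holds and fails, so both
  contribute the same, and twice that is zero modulo 2.
\<close>

lemma sum_bit_eq_0_involution: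
  fixes f :: "'b \<Rightarrow> bit"
  assumes "finite S" "\<And>b. b \<in> S \<Longrightarrow> \<sigma> b \<in> S" "\<And>b. b \<in> S \<Longrightarrow> \<sigma> (\<sigma> b) = b"
    and "\<And>b. b \<in> S \<Longrightarrow> p (\<sigma> b) \<longleftrightarrow> \<not> p b" "\<And>b. b \<in> S \<Longrightarrow> f (\<sigma> b) = f b"
  shows "sum f S = 0"
proof -
  have "sum f (S \<inter> {b. p b}) = sum f (S \<inter> - {b. p b})"
    by (rule sum.reindex_bij_witness[of _ \<sigma> \<sigma>]) (use assms in auto)
  then show ?thesis
    using sum.Int_Diff[OF assms(1), of f "{b. p b}"] by (simp add: Diff_eq)
qed

section \<open>Cocycles and weak plus-adequacy\<close>

lemma splits_unique:
  assumes "splits F D \<epsilon> \<epsilon>' \<Gamma> \<Gamma>1 \<Gamma>2" "splits F D \<epsilon> \<epsilon>' \<Gamma>' \<Gamma>1' \<Gamma>2'"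
  shows "\<Gamma>' = \<Gamma> \<and> (\<Gamma>1' = \<Gamma>1 \<and> \<Gamma>2' = \<Gamma>2 \<or> \<Gamma>1' = \<Gamma>2 \<and> \<Gamma>2' = \<Gamma>1)"
proof -
  have "{\<Gamma>'} = {\<Gamma>}" "{\<Gamma>1', \<Gamma>2'} = {\<Gamma>1, \<Gamma>2}"
    using assms unfolding splits_def by auto
  then show ?thesis by (auto simp: doubleton_eq_iff)
qed

lemma splits_commute: "splits F D \<epsilon> \<epsilon>' \<Gamma> \<Gamma>1 \<Gamma>2 \<Longrightarrow> splits F D \<epsilon> \<epsilon>' \<Gamma> \<Gamma>2 \<Gamma>1"
  unfolding splits_def by (metis insert_commute)

lemma splits_exclusive:
  assumes "splits F D \<epsilon> \<epsilon>' \<Gamma> \<Gamma>1 \<Gamma>2"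
  shows "\<not> merges F D \<epsilon> \<epsilon>' \<Gamma>' \<Gamma>1' \<Gamma>2'" "\<not> changes F D \<epsilon> \<epsilon>' \<Gamma>'' \<Gamma>'''"
  using assms unfolding splits_def merges_def changes_def by (auto simp: doubleton_eq_iff)

lemma edge_entry_L_algebra:
  "edge_entry (L_algebra \<pi>) F D \<epsilon> \<epsilon>' b b' = of_bool
    ((\<exists>j. j < ncross D \<and> j \<notin> \<epsilon> \<and> \<epsilon>' = insert j \<epsilon>) \<and>
     (\<forall>\<Gamma> \<in> circles F D \<epsilon> \<inter> circles F D \<epsilon>'. b' \<Gamma> = b \<Gamma>) \<and>
     ((\<exists>\<Gamma>1 \<Gamma>2 \<Gamma>. merges F D \<epsilon> \<epsilon>' \<Gamma>1 \<Gamma>2 \<Gamma> \<and> L_mult \<pi> (b \<Gamma>1) (b \<Gamma>2) (b' \<Gamma>) = 1) \<or>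
      (\<exists>\<Gamma> \<Gamma>1 \<Gamma>2. splits F D \<epsilon> \<epsilon>' \<Gamma> \<Gamma>1 \<Gamma>2 \<and>
         L_comult \<pi> (circle_class F D \<epsilon>' \<Gamma>1) (circle_class F D \<epsilon>' \<Gamma>2) (b \<Gamma>) (b' \<Gamma>1, b' \<Gamma>2) = 1)))"
  by (simp add: edge_entry_def)

text \<open>
  The names of the two new circles are determined up to order only, which the symmetry of
  the comultiplications makes harmless.
\<close>

lemma edge_entry_splits:
  assumes "splits F D {} {j} \<Gamma> \<Gamma>1 \<Gamma>2" "j < ncross D"
  shows "edge_entry (L_algebra \<pi>) F D {} {j} b b' = of_bool
    ((\<forall>\<Delta> \<in> circles F D {} \<inter> circles F D {j}. b' \<Delta> = b \<Delta>) \<and>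
     L_comult \<pi> (circle_class F D {j} \<Gamma>1) (circle_class F D {j} \<Gamma>2) (b \<Gamma>) (b' \<Gamma>1, b' \<Gamma>2) = 1)"
proof -
  have "(\<exists>\<Gamma> \<Gamma>1 \<Gamma>2. splits F D {} {j} \<Gamma> \<Gamma>1 \<Gamma>2 \<and> L_comult \<pi> (circle_class F D {j} \<Gamma>1)
      (circle_class F D {j} \<Gamma>2) (b \<Gamma>) (b' \<Gamma>1, b' \<Gamma>2) = 1) \<longleftrightarrow>
    L_comult \<pi> (circle_class F D {j} \<Gamma>1) (circle_class F D {j} \<Gamma>2) (b \<Gamma>) (b' \<Gamma>1, b' \<Gamma>2) = 1"
    using assms(1) splits_unique[OF assms(1)] L_comult_commute by metis
  then show ?thesis
    using assms(2) splits_exclusive[OF assms(1)] by (simp add: edge_entry_def)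
qed

context link_diagram
begin

abbreviation "H1 \<equiv> mod2_homology_group 1 F"
abbreviation "LA \<equiv> L_algebra H1"

lemma finite_state_basis: "finite (state_basis (L_algebra \<pi>) F D \<epsilon>)"
  unfolding state_basis_def by (rule finite_PiE) (auto simp: L_basis_def)

text \<open>
  Since every change of smoothing is a merge, a split or a replacement of one circle, weak
  plus-adequacy only excludes splits that produce a null-homologous circle.
\<close>

lemma weak_plus_adequate_iff:
  "weak_plus_adequate F D \<longleftrightarrow>
    (\<forall>j<ncross D. \<forall>\<Gamma> \<Gamma>1 \<Gamma>2. splits F D {} {j} \<Gamma> \<Gamma>1 \<Gamma>2 \<longrightarrow>
       circle_class F D {j} \<Gamma>1 \<noteq> \<one>\<^bsub>H1\<^esub> \<and> circle_class F D {j} \<Gamma>2 \<noteq> \<one>\<^bsub>H1\<^esub>)"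
proof (intro iffI allI impI)
  fix j \<Gamma> \<Gamma>1 \<Gamma>2
  assume w: "weak_plus_adequate F D" and j: "j < ncross D" and s: "splits F D {} {j} \<Gamma> \<Gamma>1 \<Gamma>2"
  have "{j} \<subseteq> {..<ncross D}" "card {j} = 1" using j by auto
  then obtain \<Gamma>' \<Gamma>1' \<Gamma>2' where "splits F D {} {j} \<Gamma>' \<Gamma>1' \<Gamma>2'"
      "circle_class F D {j} \<Gamma>1' \<noteq> \<one>\<^bsub>H1\<^esub>" "circle_class F D {j} \<Gamma>2' \<noteq> \<one>\<^bsub>H1\<^esub>"
    using w splits_exclusive[OF s] unfolding weak_plus_adequate_def by meson
  then show "circle_class F D {j} \<Gamma>1 \<noteq> \<one>\<^bsub>H1\<^esub> \<and> circle_class F D {j} \<Gamma>2 \<noteq> \<one>\<^bsub>H1\<^esub>"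
    using splits_unique[OF s] by metis
next
  assume w: "\<forall>j<ncross D. \<forall>\<Gamma> \<Gamma>1 \<Gamma>2. splits F D {} {j} \<Gamma> \<Gamma>1 \<Gamma>2 \<longrightarrow>
       circle_class F D {j} \<Gamma>1 \<noteq> \<one>\<^bsub>H1\<^esub> \<and> circle_class F D {j} \<Gamma>2 \<noteq> \<one>\<^bsub>H1\<^esub>"
  show "weak_plus_adequate F D"
    unfolding weak_plus_adequate_def
  proof (intro allI impI)
    fix \<epsilon> assume "\<epsilon> \<subseteq> {..<ncross D}" "card \<epsilon> = 1"
    then obtain j where \<epsilon>: "\<epsilon> = {j}" and j: "j < ncross D"
      by (auto simp: card_1_singleton_iff)
    consider "\<exists>\<Gamma>1 \<Gamma>2 \<Gamma>. merges F D {} {j} \<Gamma>1 \<Gamma>2 \<Gamma>" | "\<exists>\<Gamma> \<Gamma>1 \<Gamma>2. splits F D {} {j} \<Gamma> \<Gamma>1 \<Gamma>2"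
      | "\<exists>\<Gamma> \<Gamma>'. changes F D {} {j} \<Gamma> \<Gamma>'"
      using merges_or_splits_or_changes[OF j, of "{}" "{j}", simplified] by blast
    then show "(\<exists>\<Gamma>1 \<Gamma>2 \<Gamma>. merges F D {} \<epsilon> \<Gamma>1 \<Gamma>2 \<Gamma>) \<or>
        (\<exists>\<Gamma> \<Gamma>1 \<Gamma>2. splits F D {} \<epsilon> \<Gamma> \<Gamma>1 \<Gamma>2 \<and> circle_class F D {} \<Gamma> = \<one>\<^bsub>H1\<^esub> \<and>
           circle_class F D \<epsilon> \<Gamma>1 \<noteq> \<one>\<^bsub>H1\<^esub> \<and> circle_class F D \<epsilon> \<Gamma>2 \<noteq> \<one>\<^bsub>H1\<^esub>) \<or>
        (\<exists>\<Gamma> \<Gamma>1 \<Gamma>2. splits F D {} \<epsilon> \<Gamma> \<Gamma>1 \<Gamma>2 \<and> circle_class F D {} \<Gamma> \<noteq> \<one>\<^bsub>H1\<^esub> \<and>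
           circle_class F D \<epsilon> \<Gamma>1 \<noteq> \<one>\<^bsub>H1\<^esub> \<and> circle_class F D \<epsilon> \<Gamma>2 \<noteq> \<one>\<^bsub>H1\<^esub>) \<or>
        (\<exists>\<Gamma> \<Gamma>'. changes F D {} \<epsilon> \<Gamma> \<Gamma>')"
    proof cases
      case 2
      then obtain \<Gamma> \<Gamma>1 \<Gamma>2 where s: "splits F D {} {j} \<Gamma> \<Gamma>1 \<Gamma>2" by blast
      then have "circle_class F D {j} \<Gamma>1 \<noteq> \<one>\<^bsub>H1\<^esub>" "circle_class F D {j} \<Gamma>2 \<noteq> \<one>\<^bsub>H1\<^esub>"
        using w j by blast+
      with s show ?thesis unfolding \<epsilon> by metis
    qed (unfold \<epsilon>, blast+)
  qed
qed

text \<open>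
  The cocycle is the tensor product of \<open>x\<close> over the null-homologous circles and \<open>y\<^sub>\<alpha> + z\<^sub>\<alpha>\<close>
  over the circles of class \<open>\<alpha> \<noteq> 0\<close>. Expanded, it is the sum of the basis vectors in the set
  \<open>S\<close> below. If a change of smoothing touches a circle of nonzero class, then swapping \<open>y\<close>
  and \<open>z\<close> on all touched circles pairs off the members of \<open>S\<close> with equal images. Otherwise
  every member is mapped to zero, because \<open>x\<close> has square zero and \<open>\<Delta>\<^bsub>\<beta>,\<beta>\<^esub>(x) = 0\<close> for
  \<open>\<beta> \<noteq> 0\<close>.
\<close>

lemma nonzero_cocycle_if_weak_plus_adequate:
  assumes "weak_plus_adequate F D"
  shows "\<exists>v \<in> cocycles LA F D (- int (nneg D)). v \<noteq> (\<lambda>e. 0)"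
proof -
  let ?cl = "circle_class F D {}"
  define S where "S = {b \<in> state_basis LA F D {}. \<forall>\<Gamma>\<in>circles F D {}. ?cl \<Gamma> = \<one>\<^bsub>H1\<^esub> \<longrightarrow> b \<Gamma> = L_x}"
  define v :: "nat set \<times> ('a set \<Rightarrow> 'a chain set L_gen) \<Rightarrow> bit"
    where "v = (\<lambda>e. of_bool (e \<in> Pair {} ` S))"
  have S_basis: "b \<Gamma> \<in> L_basis H1 (?cl \<Gamma>)" "?cl \<Gamma> = \<one>\<^bsub>H1\<^esub> \<Longrightarrow> b \<Gamma> = L_x"
    if "b \<in> S" "\<Gamma> \<in> circles F D {}" for b \<Gamma>
    using that by (auto simp: S_def state_basis_def)
  have not_one: "b \<Gamma> \<noteq> L_one" if "b \<in> S" "\<Gamma> \<in> circles F D {}" for b \<Gamma>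
    using S_basis[OF that] by (cases "?cl \<Gamma> = \<one>\<^bsub>H1\<^esub>") (auto simp: L_basis_def)
  have "(\<lambda>\<Gamma>\<in>circles F D {}. if ?cl \<Gamma> = \<one>\<^bsub>H1\<^esub> then L_x else L_y (?cl \<Gamma>)) \<in> S"
    by (auto simp: S_def state_basis_def L_basis_def)
  then have "v \<noteq> (\<lambda>e. 0)" unfolding v_def fun_eq_iff by auto
  moreover have "v \<in> cocycles LA F D (- int (nneg D))"
    unfolding cocycles_lowest_iff
  proof (intro conjI allI impI ballI)
    show "v e = 0" if "e \<notin> Pair {} ` state_basis LA F D {}" for e
      using that by (auto simp: v_def S_def)
    fix j b' assume j: "j < ncross D" and "b' \<in> state_basis LA F D {j}"
    let ?T = "circles F D {} - circles F D {j}"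
    let ?e = "\<lambda>b. edge_entry LA F D {} {j} b b'"
    have ne: "circle_class F D {j} \<Gamma>1 \<noteq> \<one>\<^bsub>H1\<^esub>" "circle_class F D {j} \<Gamma>2 \<noteq> \<one>\<^bsub>H1\<^esub>"
      if "splits F D {} {j} \<Gamma> \<Gamma>1 \<Gamma>2" for \<Gamma> \<Gamma>1 \<Gamma>2
      using assms j that unfolding weak_plus_adequate_iff by blast+
    have "(\<Sum>b \<in> state_basis LA F D {}. v ({}, b) * ?e b) = sum ?e S"
      using finite_state_basis by (intro sum.mono_neutral_cong_right) (auto simp: v_def S_def)
    also have "\<dots> = 0"
    proof (cases "\<exists>\<Gamma>\<in>?T. ?cl \<Gamma> \<noteq> \<one>\<^bsub>H1\<^esub>")
      case True
      then obtain \<Delta> where \<Delta>: "\<Delta> \<in> ?T" "?cl \<Delta> \<noteq> \<one>\<^bsub>H1\<^esub>" by blast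
      define \<sigma> where "\<sigma> b = (\<lambda>\<Gamma>. if \<Gamma> \<in> ?T then L_swap (b \<Gamma>) else b \<Gamma>)" for b :: "'a set \<Rightarrow> 'a chain set L_gen"
      show ?thesis
      proof (rule sum_bit_eq_0_involution[where \<sigma> = \<sigma> and p = "\<lambda>b. b \<Delta> = L_y (?cl \<Delta>)"])
        show "finite S" unfolding S_def using finite_state_basis by simp
        fix b assume b: "b \<in> S"
        show "\<sigma> b \<in> S" using b by (auto simp: \<sigma>_def S_def state_basis_def PiE_iff extensional_def)
        show "\<sigma> (\<sigma> b) = b" by (simp add: \<sigma>_def fun_eq_iff)
        show "\<sigma> b \<Delta> = L_y (?cl \<Delta>) \<longleftrightarrow> b \<Delta> \<noteq> L_y (?cl \<Delta>)"
          using S_basis(1)[OF b, of \<Delta>] \<Delta> by (auto simp: \<sigma>_def L_basis_def)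
        have common: "\<sigma> b \<Gamma> = b \<Gamma>" if "\<Gamma> \<in> circles F D {} \<inter> circles F D {j}" for \<Gamma>
          using that by (simp add: \<sigma>_def)
        have mult: "L_mult H1 (\<sigma> b \<Gamma>1) (\<sigma> b \<Gamma>2) = L_mult H1 (b \<Gamma>1) (b \<Gamma>2)"
          if "merges F D {} {j} \<Gamma>1 \<Gamma>2 \<Gamma>" for \<Gamma>1 \<Gamma>2 \<Gamma>
        proof -
          have "\<Gamma>1 \<in> ?T" "\<Gamma>2 \<in> ?T" using that unfolding merges_def by blast+
          moreover from this have "b \<Gamma>1 \<noteq> L_one" "b \<Gamma>2 \<noteq> L_one"
            using not_one[OF b] by blast+
          ultimately show ?thesis by (simp add: \<sigma>_def L_mult_swap)
        qed
        have comult: "L_comult H1 (circle_class F D {j} \<Gamma>1) (circle_class F D {j} \<Gamma>2) (\<sigma> b \<Gamma>)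
            = L_comult H1 (circle_class F D {j} \<Gamma>1) (circle_class F D {j} \<Gamma>2) (b \<Gamma>)"
          if "splits F D {} {j} \<Gamma> \<Gamma>1 \<Gamma>2" for \<Gamma> \<Gamma>1 \<Gamma>2
        proof -
          have "\<Gamma> \<in> ?T" using that unfolding splits_def by blast
          then show ?thesis using L_comult_swap[OF ne[OF that]] by (simp add: \<sigma>_def)
        qed
        show "?e (\<sigma> b) = ?e b"
          unfolding edge_entry_L_algebra
          by (intro arg_cong[of _ _ of_bool] conj_cong disj_cong ex_cong1 ball_cong refl)
            (simp_all only: common mult comult)
      qed
    next
      case False
      have "?e b = 0" if b: "b \<in> S" for b
      proof -
        have x: "b \<Gamma> = L_x" if "\<Gamma> \<in> ?T" for \<Gamma>
          using S_basis(2)[OF b, of \<Gamma>] False that by blast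
        have "L_mult H1 (b \<Gamma>1) (b \<Gamma>2) (b' \<Gamma>) \<noteq> 1" if "merges F D {} {j} \<Gamma>1 \<Gamma>2 \<Gamma>" for \<Gamma>1 \<Gamma>2 \<Gamma>
        proof -
          have "\<Gamma>1 \<in> ?T" "\<Gamma>2 \<in> ?T" using that unfolding merges_def by blast+
          then show ?thesis using x by simp
        qed
        moreover have "L_comult H1 (circle_class F D {j} \<Gamma>1) (circle_class F D {j} \<Gamma>2) (b \<Gamma>) (b' \<Gamma>1, b' \<Gamma>2) \<noteq> 1"
          if s: "splits F D {} {j} \<Gamma> \<Gamma>1 \<Gamma>2" for \<Gamma> \<Gamma>1 \<Gamma>2
        proof -
          have "\<Gamma> \<in> ?T" using s unfolding splits_def by blast
          then have "b \<Gamma> = L_x" "?cl \<Gamma> = \<one>\<^bsub>H1\<^esub>" using x False by blast+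
          moreover from this have "circle_class F D {j} \<Gamma>1 = circle_class F D {j} \<Gamma>2"
            using splits_null_circle[OF j _ _ s] by simp
          ultimately show ?thesis using ne[OF s] by (simp add: L_comult_def)
        qed
        ultimately have "\<not> (\<exists>\<Gamma>1 \<Gamma>2 \<Gamma>. merges F D {} {j} \<Gamma>1 \<Gamma>2 \<Gamma> \<and> L_mult H1 (b \<Gamma>1) (b \<Gamma>2) (b' \<Gamma>) = 1)"
          "\<not> (\<exists>\<Gamma> \<Gamma>1 \<Gamma>2. splits F D {} {j} \<Gamma> \<Gamma>1 \<Gamma>2 \<and>
            L_comult H1 (circle_class F D {j} \<Gamma>1) (circle_class F D {j} \<Gamma>2) (b \<Gamma>) (b' \<Gamma>1, b' \<Gamma>2) = 1)"
          by blast+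
        then show ?thesis by (simp only: edge_entry_L_algebra simp_thms of_bool_eq)
      qed
      then show ?thesis by simp
    qed
    finally show "(\<Sum>b \<in> state_basis LA F D {}. v ({}, b) * ?e b) = 0" .
  qed
  ultimately show ?thesis by blast
qed

text \<open>
  The coefficient of a basis vector \<open>b\<close> in a cocycle is read off at the basis vector \<open>b'\<close>
  which agrees with \<open>b\<close> on the untouched circles, is \<open>x\<close> on the null-homologous new circle,
  and on the other one takes the value of \<open>b\<close> on the circle that was split: by the counit
  property, \<open>b\<close> is the only basis vector whose image involves \<open>b'\<close>.
\<close>

lemma cocycle_eq_0_if_splits_off_null_circle:
  assumes j: "j < ncross D" and s: "splits F D {} {j} \<Gamma> \<Gamma>1 \<Gamma>2"
    and null: "circle_class F D {j} \<Gamma>1 = \<one>\<^bsub>H1\<^esub>"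
    and v: "v \<in> cocycles LA F D (- int (nneg D))"
  shows "v = (\<lambda>e. 0)"
proof -
  let ?A = "circles F D {}" and ?B = "circles F D {j}"
  have \<Gamma>: "\<Gamma>1 \<noteq> \<Gamma>2" "?A = insert \<Gamma> (?A \<inter> ?B)" "?B = {\<Gamma>1, \<Gamma>2} \<union> (?A \<inter> ?B)"
    "\<Gamma> \<notin> ?B" "\<Gamma>1 \<notin> ?A" "\<Gamma>2 \<notin> ?A" "\<Gamma>1 \<in> ?B" "\<Gamma>2 \<in> ?B" "\<Gamma> \<in> ?A"
    using s unfolding splits_def by blast+
  have \<Gamma>2: "circle_class F D {j} \<Gamma>2 = circle_class F D {} \<Gamma>"
    using splits_off_null_circle[OF j _ _ s null] by simp
  have same: "circle_class F D {j} \<Delta> = circle_class F D {} \<Delta>" if "\<Delta> \<in> ?A \<inter> ?B" for \<Delta>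
    using circle_chain_cong[OF j, of "{}" "{j}" \<Delta>] that by (simp add: circle_class_eq)
  have "v ({}, b) = 0" if b: "b \<in> state_basis LA F D {}" for b
  proof -
    define b' where "b' = (\<lambda>\<Delta>\<in>?B. if \<Delta> = \<Gamma>1 then L_x else if \<Delta> = \<Gamma>2 then b \<Gamma> else b \<Delta>)"
    have bb: "b \<Delta> \<in> L_basis H1 (circle_class F D {} \<Delta>)" if "\<Delta> \<in> ?A" for \<Delta>
      using b that by (auto simp: state_basis_def)
    have b': "b' \<in> state_basis LA F D {j}"
      unfolding state_basis_def
    proof (rule PiE_I)
      fix \<Delta> assume "\<Delta> \<in> ?B"
      then consider "\<Delta> = \<Gamma>1" | "\<Delta> = \<Gamma>2" | "\<Delta> \<in> ?A \<inter> ?B" using \<Gamma>(3) by blast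
      then show "b' \<Delta> \<in> xbasis LA (circle_class F D {j} \<Delta>)"
      proof cases
        case 1
        then show ?thesis using \<Gamma>(7) null by (simp add: b'_def L_basis_def)
      next
        case 2
        then show ?thesis using \<Gamma>(1,8) \<Gamma>2 bb[OF \<Gamma>(9)] by (simp add: b'_def)
      next
        case 3
        then have "\<Delta> \<noteq> \<Gamma>1" "\<Delta> \<noteq> \<Gamma>2" using \<Gamma>(5,6) by blast+
        then show ?thesis using 3 same[OF 3] bb[of \<Delta>] by (simp add: b'_def)
      qed
    qed (simp add: b'_def)
    have entry: "edge_entry LA F D {} {j} c b' = of_bool (c = b)" if c: "c \<in> state_basis LA F D {}" for c
    proof -
      have cc: "c \<Gamma> \<in> L_basis H1 (circle_class F D {} \<Gamma>)"
        using c \<Gamma>(9) by (auto simp: state_basis_def)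
      have common: "b' \<Delta> = b \<Delta>" if "\<Delta> \<in> ?A \<inter> ?B" for \<Delta>
        proof -
        have "\<Delta> \<noteq> \<Gamma>1" "\<Delta> \<noteq> \<Gamma>2" "\<Delta> \<in> ?B" using that \<Gamma>(5,6) by blast+
        then show ?thesis by (simp add: b'_def)
      qed
      have "b' \<Gamma>1 = L_x" "b' \<Gamma>2 = b \<Gamma>" using \<Gamma>(1,7,8) by (simp_all add: b'_def)
      then have "edge_entry LA F D {} {j} c b' = of_bool ((\<forall>\<Delta> \<in> ?A \<inter> ?B. b \<Delta> = c \<Delta>) \<and> c \<Gamma> = b \<Gamma>)"
        using edge_entry_splits[OF s j, of H1 c b'] null \<Gamma>2 L_comult_counit[OF cc bb[OF \<Gamma>(9)]] common
        by simp
      moreover have "c = b" if "\<forall>\<Delta> \<in> ?A \<inter> ?B. b \<Delta> = c \<Delta>" "c \<Gamma> = b \<Gamma>"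
      proof (rule PiE_ext[OF c[unfolded state_basis_def] b[unfolded state_basis_def]])
        fix \<Delta> assume "\<Delta> \<in> ?A"
        then have "\<Delta> = \<Gamma> \<or> \<Delta> \<in> ?A \<inter> ?B" using \<Gamma>(2) by (metis insertE)
        then show "c \<Delta> = b \<Delta>" using that by metis
      qed
      ultimately show ?thesis by auto
    qed
    have "0 = (\<Sum>c \<in> state_basis LA F D {}. v ({}, c) * edge_entry LA F D {} {j} c b')"
      using v j b' unfolding cocycles_lowest_iff by simp
    also have "\<dots> = (\<Sum>c \<in> state_basis LA F D {}. if c = b then v ({}, c) else 0)"
    proof (rule sum.cong[OF refl])
      fix c assume "c \<in> state_basis LA F D {}"
      then show "v ({}, c) * edge_entry LA F D {} {j} c b' = (if c = b then v ({}, c) else 0)"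
        by (simp only: entry) simp
    qed
    also have "\<dots> = v ({}, b)" using b finite_state_basis by simp
    finally show ?thesis by simp
  qed
  then have "v e = 0" if "e \<in> Pair {} ` state_basis LA F D {}" for e using that by auto
  moreover have "v e = 0" if "e \<notin> Pair {} ` state_basis LA F D {}" for e
    using that v unfolding cocycles_lowest_iff by blast
  ultimately show ?thesis by (metis ext)
qed

lemma lowest_cohomology_nontrivial_iff_weak_plus_adequate:
  "carrier (link_cohomology LA F D (- int (nneg D))) \<noteq> {\<one>\<^bsub>link_cohomology LA F D (- int (nneg D))\<^esub>}
   \<longleftrightarrow> weak_plus_adequate F D"
  unfolding lowest_cohomology_nontrivial_iff
proof
  assume "\<exists>v \<in> cocycles LA F D (- int (nneg D)). v \<noteq> (\<lambda>e. 0)"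
  then obtain v where v: "v \<in> cocycles LA F D (- int (nneg D))" "v \<noteq> (\<lambda>e. 0)" by blast
  show "weak_plus_adequate F D"
    unfolding weak_plus_adequate_iff
  proof (intro allI impI)
    fix j \<Gamma> \<Gamma>1 \<Gamma>2 assume j: "j < ncross D" and s: "splits F D {} {j} \<Gamma> \<Gamma>1 \<Gamma>2"
    have "circle_class F D {j} \<Gamma>' \<noteq> \<one>\<^bsub>H1\<^esub>" if "splits F D {} {j} \<Gamma> \<Gamma>' \<Gamma>''" for \<Gamma>' \<Gamma>''
      using cocycle_eq_0_if_splits_off_null_circle[OF j that _ v(1)] v(2) by (rule contrapos_nn[rotated])
    then show "circle_class F D {j} \<Gamma>1 \<noteq> \<one>\<^bsub>H1\<^esub> \<and> circle_class F D {j} \<Gamma>2 \<noteq> \<one>\<^bsub>H1\<^esub>"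
      using s splits_commute[OF s] by (intro conjI)
  qed
qed (rule nonzero_cocycle_if_weak_plus_adequate)

end

theorem theorem1p5:
  fixes F :: "'a topology"
    and \<A> :: "('a set \<times> ('a \<Rightarrow> complex)) set"
    and D :: "'a diagram"
  assumes "oriented_compact_surface F \<A>"
    and "oriented_link_diagram F \<A> D"
  shows "carrier (link_cohomology (L_algebra (mod2_homology_group 1 F)) F D (- int (nneg D)))
           \<noteq> {\<one>\<^bsub>link_cohomology (L_algebra (mod2_homology_group 1 F)) F D (- int (nneg D))\<^esub>}
         \<longleftrightarrow> weak_plus_adequate F D"
proof -
  have "link_diagram F D"
  proof
    note d = assms(2)[unfolded oriented_link_diagram_def]
    note discs = d[THEN conjunct1] and disjoint_discs = d[THEN conjunct2, THEN conjunct1]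
    note d = d[THEN conjunct2, THEN conjunct2]
    note edges = d[THEN conjunct1] and interiors = d[THEN conjunct2, THEN conjunct1]
    note d = d[THEN conjunct2, THEN conjunct2]
    note disjoint_edges = d[THEN conjunct1] and loops = d[THEN conjunct2]
    show "Hausdorff_space F"
      using assms(1) by (simp add: oriented_compact_surface_def)
    show "embedding_map (top_of_set (cball 0 1)) F (disc D i)" if "i < ncross D" for i
      using discs[rule_format, OF that] by (rule conjunct1)
    show "disjnt (disc D i ` cball 0 1) (disc D j ` cball 0 1)"
      if "i < ncross D" "j < ncross D" "i \<noteq> j" for i j
      using disjoint_discs that by simp
    show "pathin F (edge D i s)" "edge D i s 0 = out_port D i s"
      "\<exists>j<ncross D. \<exists>t. edge D i s 1 = in_port D j t" if "i < ncross D" for i s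
      using edges[rule_format, OF that, of s] by - (elim conjE, assumption)+
    show "disjnt (edge D i s ` {0<..<1}) (disc D j ` cball 0 1)"
      if "i < ncross D" "j < ncross D" for i j s
      using interiors that by simp
    show "disjnt (edge D i s ` {0..1}) (edge D j t ` {0..1})"
      if "i < ncross D" "j < ncross D" "(i, s) \<noteq> (j, t)" for i j s t
      using disjoint_edges[rule_format, OF that] .
    show "pathin F (loop D k)" if "k < nloops D" for k
      using loops[THEN spec, THEN mp, OF that] by (rule conjunct1)
    show "disjnt (loop D k ` {0..1}) (disc D i ` cball 0 1)" if "k < nloops D" "i < ncross D" for k i
      using loops[THEN spec, THEN mp, OF that(1)] that(2) by simp
  qed
  then show ?thesis
    by (rule link_diagram.lowest_cohomology_nontrivial_iff_weak_plus_adequate)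
qed

end
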